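(* Let $u$ be a smooth solution of $\partial_tu+\sum_{i=1}^2\partial_{x_i}f_i(u)=0$ in a neighborhood of a skeleton point $x_\sigma$, let $w=\Psi(u)$, and assume that $u(x,t)$ remains in a compact subset of $\mathring G$, so that all Jacobians $D\Psi$ and $D\Psi^{-1}$ involved are uniformly bounded. Define hybrid data from the exact solution by $\bar u_K=\frac1{|K|}\int_Ku(x,t)\,dx$, $u_\sigma=u(x_\sigma,t)$, and let each reconstruction $u_K$ entering the point operator $\mathcal D^{\mathrm{pt}}$ at $\sigma$ (see context) satisfy $$\|u_K-u\|_{L^\infty(\overline K)}\le Ch^{p+1},\qquad\|\nabla u_K-\nabla u\|_{L^\infty(\overline K)}\le Ch^p$$ for a fixed integer $p\ge1$ with $C$ independent of $h$. At boundary points assume in addition that the boundary treatment supplies exterior directional derivatives that are $O(h^p)$ consistent. Then the semi-discrete point operator is consistent with the transformed PDE in the sense that $$\Bigl\|(\mathcal D^{\mathrm{pt}}(u_h))_\sigma+\sum_{i=1}^2J_i\bigl(u(x_\sigma,t)\bigr)\,\partial_{x_i}w(x_\sigma,t)\Bigr\|_2\le C'h^p,$$ where $C'>0$ is independent of $h$. Equivalently, $\|(\mathcal D^{\mathrm{pt}}(u_h))_\sigma-\partial_tw(x_\sigma,t)\|_2\le C'h^p$.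
   Context: $u\in\mathbb R^m$, $A_i=Df_i$, system hyperbolic. $\mathring G\subset\mathbb R^m$ is the open admissible interior $\{u:g_j(u)>0\ \forall j\in\mathcal J\}$ defined by finitely many concave $C^1$ functions $g_j$; $\Psi:\mathring G\to\mathbb R^m$ is a bijection, $C^1$, $D\Psi(u)$ invertible, $\Psi,\Psi^{-1}$ locally Lipschitz, and for smooth solutions in $\mathring G$, $w=\Psi(u)$ satisfies $\partial_tw+\sum_iJ_i(u)\partial_{x_i}w=0$ with $J_i=D\Psi A_i(D\Psi)^{-1}$. Mesh and data: $\mathcal T_h$ is a conforming, shape-regular mesh of open convex polygonal cells $K$ of $\Omega\subseteq\mathbb R^2$ (uniformly bounded number of edges per cell), $h$ its mesh size (maximal cell diameter); $\Sigma_h$ is a finite set of nodes $\sigma$ (vertices and edge midpoints) with coordinates $x_\sigma$; $u_h=((\bar u_K)_K,(u_\sigma)_\sigma)$; the reconstruction $u_K=\mathcal R_K(u_h)$ has cell average $\bar u_K$ and $u_K(x_\sigma)=u_\sigma$ for all nodes on $\partial K$. Point operator: $J_q=\sum_iq_iJ_i$ and $\partial_qw_{K,\sigma}:=D\Psi(u_\sigma)(q\cdot\nabla u_K(x_\sigma))$. Let $\mathcal E_\sigma$ be the edges containing $x_\sigma$; for $e\in\mathcal E_\sigma$, $\tau_{\sigma,e}$ is the unit tangent oriented away from $x_\sigma$, $n_{\sigma,e}$ the unit normal such that $(n_{\sigma,e},\tau_{\sigma,e})$ is a right-handed orthonormal basis, pointing from cell $K^-_{\sigma,e}$ to cell $K^+_{\sigma,e}$.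 For a vertex, $K^{\mathrm{ext}}_{\sigma,e}$ is the cell containing $x_\sigma-\varepsilon\tau_{\sigma,e}$ for small $\varepsilon>0$ (ties broken deterministically). With $\theta_{K,\sigma}$ the interior angle of $K$ at $\sigma$, $\theta_{\sigma,e}=\frac12(\theta_{K^-_{\sigma,e},\sigma}+\theta_{K^+_{\sigma,e},\sigma})$ (only $\frac12\theta_{K^-_{\sigma,e},\sigma}$ on a boundary edge) and $\omega_{\sigma,e}=\theta_{\sigma,e}/\sum_{e'\in\mathcal E_\sigma}\theta_{\sigma,e'}$. $\alpha_\sigma>0$ is chosen not less than the spectral radii of $J_{n_{\sigma,e}}(u_\sigma),J_{\tau_{\sigma,e}}(u_\sigma)$, $e\in\mathcal E_\sigma$; $J_q^\pm=\frac12(J_q(u_\sigma)\pm\alpha_\sigma I)$. For a vertex, $$(\mathcal D^{\mathrm{pt}}(u_h))_\sigma=-\sum_{e\in\mathcal E_\sigma}\omega_{\sigma,e}\bigl(J^+_{n_{\sigma,e}}\partial_{n_{\sigma,e}}w_{K^-_{\sigma,e},\sigma}+J^-_{n_{\sigma,e}}\partial_{n_{\sigma,e}}w_{K^+_{\sigma,e},\sigma}+J^-_{\tau_{\sigma,e}}\partial_{\tau_{\sigma,e}}w_{K^-_{\sigma,e},\sigma}+J^+_{\tau_{\sigma,e}}\partial_{\tau_{\sigma,e}}w_{K^{\mathrm{ext}}_{\sigma,e},\sigma}\bigr);$$ for the midpoint of $e$, $$(\mathcal D^{\mathrm{pt}}(u_h))_\sigma=-\bigl(J^+_{n_{\sigma,e}}\partial_{n_{\sigma,e}}w_{K^-_{\sigma,e},\sigma}+J^-_{n_{\sigma,e}}\partial_{n_{\sigma,e}}w_{K^+_{\sigma,e},\sigma}+J_{\tau_{\sigma,e}}\partial_{\tau_{\sigma,e}}w_{K^-_{\sigma,e},\sigma}\bigr).$$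 Missing directional derivatives at the boundary are supplied by the boundary treatment; "$O(h^p)$ consistent" means they differ from the corresponding exact directional derivatives by $O(h^p)$.
   Formalization: The viscosity parameters $\alpha_\sigma$ are additionally assumed bounded above independently of $h$ (the claim fails if $\alpha_\sigma\to\infty$ as $h\to0$); the $g_j$ are read as functions on all of $\mathbb R^m$ and each $u_K$ as $C^1$ on $\overline K$. *)

theory Defs
  imports "HOL-Probability.Essential_Supremum"
begin

section \<open>Smoothness\<close>

text \<open>Derivatives are taken within the set \<open>S\<close>, so that functions that are only given on a
  closed cell or on the closure of the domain are covered; for open \<open>S\<close> this is the usual
  notion.\<close>

definition C1_on :: "'a::real_normed_vector set \<Rightarrow> ('a \<Rightarrow> 'b::real_normed_vector) \<Rightarrow> bool" where
  "C1_on S f \<longleftrightarrow> (\<exists>f' :: 'a \<Rightarrow> 'a \<Rightarrow>\<^sub>L 'b.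
     (\<forall>x\<in>S. (f has_derivative blinfun_apply (f' x)) (at x within S)) \<and> continuous_on S f')"

definition locally_lipschitz_on :: "'a::metric_space set \<Rightarrow> ('a \<Rightarrow> 'b::metric_space) \<Rightarrow> bool" where
  "locally_lipschitz_on S f \<longleftrightarrow> (\<forall>x\<in>S. \<exists>r>0. \<exists>L. L-lipschitz_on (ball x r \<inter> S) f)"

definition Linf_norm :: "(real^2) set \<Rightarrow> (real^2 \<Rightarrow> 'b::real_normed_vector) \<Rightarrow> ereal" where
  "Linf_norm S g = esssup (lebesgue_on S) (\<lambda>x. ereal (norm (g x)))"

definition partial_deriv :: "(real^2) set \<Rightarrow> 2 \<Rightarrow> (real^2 \<Rightarrow> real^'m) \<Rightarrow> real^2 \<Rightarrow> real^'m" where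
  "partial_deriv S i g x = jacobian g (at x within S) *v axis i 1"


section \<open>The hyperbolic system and the change of variables\<close>

definition admissible_interior :: "'j set \<Rightarrow> ('j \<Rightarrow> real^'m \<Rightarrow> real) \<Rightarrow> (real^'m) set" where
  "admissible_interior J g = {v. \<forall>j\<in>J. g j v > 0}"

definition A_dir :: "(2 \<Rightarrow> real^'m \<Rightarrow> real^'m) \<Rightarrow> real^2 \<Rightarrow> real^'m \<Rightarrow> real^'m^'m" where
  "A_dir f q v = (\<Sum>i\<in>UNIV. (q $ i) *\<^sub>R jacobian (f i) (at v))"

definition real_diagonalizable :: "real^'m^'m \<Rightarrow> bool" where
  "real_diagonalizable M \<longleftrightarrow>
     (\<exists>P D :: real^'m^'m. invertible P \<and> (\<forall>i j. i \<noteq> j \<longrightarrow> D $ i $ j = 0) \<and> M = P ** D ** matrix_inv P)"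

definition hyperbolic_on :: "(real^'m) set \<Rightarrow> (2 \<Rightarrow> real^'m \<Rightarrow> real^'m) \<Rightarrow> bool" where
  "hyperbolic_on G f \<longleftrightarrow> (\<forall>v\<in>G. \<forall>q. real_diagonalizable (A_dir f q v))"

definition change_of_variables :: "(real^'m) set \<Rightarrow> (real^'m \<Rightarrow> real^'m) \<Rightarrow> bool" where
  "change_of_variables G \<Psi> \<longleftrightarrow> bij_betw \<Psi> G UNIV \<and> C1_on G \<Psi> \<and>
     (\<forall>v\<in>G. invertible (jacobian \<Psi> (at v))) \<and>
     locally_lipschitz_on G \<Psi> \<and> locally_lipschitz_on UNIV (inv_into G \<Psi>)"

definition J_mat ::
  "(real^'m \<Rightarrow> real^'m) \<Rightarrow> (2 \<Rightarrow> real^'m \<Rightarrow> real^'m) \<Rightarrow> 2 \<Rightarrow> real^'m \<Rightarrow> real^'m^'m" where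
  "J_mat \<Psi> f i v = jacobian \<Psi> (at v) ** jacobian (f i) (at v) ** matrix_inv (jacobian \<Psi> (at v))"

definition J_dir ::
  "(real^'m \<Rightarrow> real^'m) \<Rightarrow> (2 \<Rightarrow> real^'m \<Rightarrow> real^'m) \<Rightarrow> real^2 \<Rightarrow> real^'m \<Rightarrow> real^'m^'m" where
  "J_dir \<Psi> f q v = (\<Sum>i\<in>UNIV. (q $ i) *\<^sub>R J_mat \<Psi> f i v)"

text \<open>Real matrices may have complex eigenvalues, hence the complexification.\<close>

definition spec_radius :: "real^'m^'m \<Rightarrow> real" where
  "spec_radius M = Sup {cmod l | l. \<exists>z :: complex^'m. z \<noteq> 0 \<and>
     (\<chi> i j. complex_of_real (M $ i $ j)) *v z = l *s z}"

text \<open>\<open>Q\<close> is a space-time set, relatively open in \<open>closure \<Omega> \<times> UNIV\<close>. Spatial derivatives are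
  taken within \<open>closure \<Omega>\<close>, so at a boundary point nothing is required of \<open>u\<close> outside the domain.\<close>

definition smooth_solution ::
  "(real^2) set \<Rightarrow> (2 \<Rightarrow> real^'m \<Rightarrow> real^'m) \<Rightarrow> ((real^2) \<times> real) set \<Rightarrow>
   (real^2 \<Rightarrow> real \<Rightarrow> real^'m) \<Rightarrow> bool" where
  "smooth_solution \<Omega> f Q u \<longleftrightarrow>
     openin (top_of_set (closure \<Omega> \<times> UNIV)) Q \<and>
     C1_on Q (\<lambda>(x, t). u x t) \<and>
     (\<forall>(x, t)\<in>Q. vector_derivative (\<lambda>s. u x s) (at t)
        + (\<Sum>i\<in>UNIV. partial_deriv (closure \<Omega>) i (\<lambda>y. f i (u y t)) x) = 0)"


section \<open>Meshes\<close>

type_synonym cell = "(real^2) set"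
type_synonym edge = "(real^2) set"
type_synonym node = "real^2"   (* a node is identified with its coordinates *)

definition mesh_of :: "(real^2) set \<Rightarrow> cell set \<Rightarrow> bool" where
  "mesh_of \<Omega> T \<longleftrightarrow> finite T \<and>
     (\<forall>K\<in>T. open K \<and> convex K \<and> K \<noteq> {} \<and> polytope (closure K)) \<and>
     pairwise disjnt T \<and> \<Union>T \<subseteq> \<Omega> \<and> closure \<Omega> = (\<Union>K\<in>T. closure K)"

text \<open>Two closed cells meet in a common face: nothing, a vertex, or a full edge.\<close>

definition conforming :: "cell set \<Rightarrow> bool" where
  "conforming T \<longleftrightarrow> (\<forall>K\<in>T. \<forall>L\<in>T. (closure K \<inter> closure L) face_of closure K)"

definition shape_regular :: "real \<Rightarrow> nat \<Rightarrow> cell set \<Rightarrow> bool" where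
  "shape_regular \<rho> N T \<longleftrightarrow> (\<forall>K\<in>T. (\<exists>c. ball c (\<rho> * diameter K) \<subseteq> K) \<and>
     card {e. e edge_of closure K} \<le> N)"

definition mesh_size :: "cell set \<Rightarrow> real" where
  "mesh_size T = Max (diameter ` T)"

definition mesh_edges :: "cell set \<Rightarrow> edge set" where
  "mesh_edges T = {e. \<exists>K\<in>T. e edge_of closure K}"

definition mesh_vertices :: "cell set \<Rightarrow> node set" where
  "mesh_vertices T = {v. \<exists>K\<in>T. v extreme_point_of closure K}"

definition midpoint_of_edge :: "node \<Rightarrow> edge \<Rightarrow> bool" where
  "midpoint_of_edge x e \<longleftrightarrow> (\<exists>a b. e = closed_segment a b \<and> x = midpoint a b)"

definition mesh_nodes :: "cell set \<Rightarrow> node set" where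
  "mesh_nodes T = mesh_vertices T \<union> {x. \<exists>e\<in>mesh_edges T. midpoint_of_edge x e}"

definition edges_at :: "cell set \<Rightarrow> node \<Rightarrow> edge set" where
  "edges_at T x = {e \<in> mesh_edges T. x \<in> e}"

definition cells_at :: "cell set \<Rightarrow> node \<Rightarrow> cell set" where
  "cells_at T x = {K \<in> T. x \<in> closure K}"

text \<open>Angular measure of the set of directions that point from \<open>x\<close> into \<open>K\<close>.\<close>

definition interior_angle :: "cell \<Rightarrow> node \<Rightarrow> real" where
  "interior_angle K x = measure lborel
     {\<phi> \<in> {0..<2 * pi}. \<forall>\<^sub>F \<epsilon> in at_right 0. x + \<epsilon> *\<^sub>R vector [cos \<phi>, sin \<phi>] \<in> K}"

text \<open>If \<open>x\<close> is an endpoint of \<open>e\<close> this determines the tangent pointing away from \<open>x\<close>; if \<open>x\<close> is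
  the midpoint, both unit tangents of \<open>e\<close> are allowed.\<close>

definition unit_tangent :: "node \<Rightarrow> edge \<Rightarrow> real^2 \<Rightarrow> bool" where
  "unit_tangent x e \<tau> \<longleftrightarrow> norm \<tau> = 1 \<and> (\<exists>s>0. x + s *\<^sub>R \<tau> \<in> e)"

text \<open>The unit normal \<open>n\<close> for which \<open>(n, \<tau>)\<close> is right-handed, i.e. has determinant \<open>1\<close>.\<close>

definition normal_of :: "real^2 \<Rightarrow> real^2" where
  "normal_of \<tau> = vector [\<tau> $ 2, - (\<tau> $ 1)]"

text \<open>The cell adjacent to \<open>e\<close> on the side into which \<open>d\<close> points; there is at most one, and
  none if that side of \<open>e\<close> lies outside the domain.\<close>

definition side_cell :: "cell set \<Rightarrow> node \<Rightarrow> edge \<Rightarrow> real^2 \<Rightarrow> cell option" where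
  "side_cell T x e d =
     (let P = (\<lambda>K. K \<in> T \<and> e edge_of closure K \<and> (\<forall>y\<in>K. d \<bullet> (y - x) > 0))
      in if \<exists>K. P K then Some (SOME K. P K) else None)"

text \<open>The cells that contain \<open>x - \<epsilon> \<tau>\<close> for small \<open>\<epsilon>\<close>. Closed cells are used so that the case
  where the ray runs along an edge is included; then there may be two candidates.\<close>

definition ext_candidates :: "cell set \<Rightarrow> node \<Rightarrow> real^2 \<Rightarrow> cell set" where
  "ext_candidates T x \<tau> = {K \<in> T. \<forall>\<^sub>F \<epsilon> in at_right 0. x - \<epsilon> *\<^sub>R \<tau> \<in> closure K}"


section \<open>The point operator\<close>

text \<open>Hybrid data: cell averages and node values.\<close>

type_synonym 'm hybrid = "(cell \<Rightarrow> real^'m) \<times> (node \<Rightarrow> real^'m)"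

text \<open>The four one-sided derivatives attached to a node and an edge: normal derivative from
  \<open>K\<^sup>-\<close> and from \<open>K\<^sup>+\<close>, tangential derivative from \<open>K\<^sup>-\<close> and from \<open>K\<^sup>e\<^sup>x\<^sup>t\<close>.\<close>

datatype slot = N_minus | N_plus | T_minus | T_ext

text \<open>\<open>ext_cell\<close> is the tie-breaking rule for \<open>K\<^sup>e\<^sup>x\<^sup>t\<close>; \<open>bdry\<close> is the boundary treatment, read only
  where the cell belonging to a slot does not exist.\<close>

record ('m::finite) discretization =
  cells :: "cell set"
  tang :: "node \<Rightarrow> edge \<Rightarrow> real^2"
  ext_cell :: "node \<Rightarrow> edge \<Rightarrow> cell"
  visc :: "node \<Rightarrow> real"
  recon :: "cell \<Rightarrow> 'm hybrid \<Rightarrow> real^2 \<Rightarrow> real^'m"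
  bdry :: "node \<Rightarrow> edge \<Rightarrow> slot \<Rightarrow> real^'m"

definition norml :: "'m::finite discretization \<Rightarrow> node \<Rightarrow> edge \<Rightarrow> real^2" where
  "norml D x e = normal_of (tang D x e)"

definition K_minus :: "'m::finite discretization \<Rightarrow> node \<Rightarrow> edge \<Rightarrow> cell option" where
  "K_minus D x e = side_cell (cells D) x e (- norml D x e)"

definition K_plus :: "'m::finite discretization \<Rightarrow> node \<Rightarrow> edge \<Rightarrow> cell option" where
  "K_plus D x e = side_cell (cells D) x e (norml D x e)"

definition K_ext :: "'m::finite discretization \<Rightarrow> node \<Rightarrow> edge \<Rightarrow> cell option" where
  "K_ext D x e = (if ext_candidates (cells D) x (tang D x e) = {} then None
                  else Some (ext_cell D x e))"

definition well_oriented :: "'m::finite discretization \<Rightarrow> bool" where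
  "well_oriented D \<longleftrightarrow> (\<forall>x\<in>mesh_nodes (cells D). \<forall>e\<in>edges_at (cells D) x.
     unit_tangent x e (tang D x e) \<and>
     (ext_candidates (cells D) x (tang D x e) \<noteq> {} \<longrightarrow>
        ext_cell D x e \<in> ext_candidates (cells D) x (tang D x e)))"

fun slot_cell :: "'m::finite discretization \<Rightarrow> node \<Rightarrow> edge \<Rightarrow> slot \<Rightarrow> cell option" where
  "slot_cell D x e N_minus = K_minus D x e"
| "slot_cell D x e N_plus = K_plus D x e"
| "slot_cell D x e T_minus = K_minus D x e"
| "slot_cell D x e T_ext = K_ext D x e"

fun slot_dir :: "'m::finite discretization \<Rightarrow> node \<Rightarrow> edge \<Rightarrow> slot \<Rightarrow> real^2" where
  "slot_dir D x e N_minus = norml D x e"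
| "slot_dir D x e N_plus = norml D x e"
| "slot_dir D x e T_minus = tang D x e"
| "slot_dir D x e T_ext = tang D x e"

text \<open>On a boundary edge only the one adjacent cell contributes.\<close>

definition edge_angle :: "'m::finite discretization \<Rightarrow> node \<Rightarrow> edge \<Rightarrow> real" where
  "edge_angle D x e =
     (case K_minus D x e of None \<Rightarrow> 0 | Some K \<Rightarrow> interior_angle K x) / 2
   + (case K_plus D x e of None \<Rightarrow> 0 | Some K \<Rightarrow> interior_angle K x) / 2"

definition edge_weight :: "'m::finite discretization \<Rightarrow> node \<Rightarrow> edge \<Rightarrow> real" where
  "edge_weight D x e = edge_angle D x e / (\<Sum>e'\<in>edges_at (cells D) x. edge_angle D x e')"

definition dw :: "(real^'m \<Rightarrow> real^'m) \<Rightarrow> 'm discretization \<Rightarrow> 'm hybrid \<Rightarrow>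
    node \<Rightarrow> edge \<Rightarrow> slot \<Rightarrow> real^'m" where
  "dw \<Psi> D uh x e s = (case slot_cell D x e s of
     Some K \<Rightarrow> jacobian \<Psi> (at (snd uh x)) *v
                (jacobian (recon D K uh) (at x within closure K) *v slot_dir D x e s)
   | None \<Rightarrow> bdry D x e s)"

definition J_plus :: "(real^'m \<Rightarrow> real^'m) \<Rightarrow> (2 \<Rightarrow> real^'m \<Rightarrow> real^'m) \<Rightarrow> real \<Rightarrow> real^2 \<Rightarrow>
    real^'m \<Rightarrow> real^'m^'m" where
  "J_plus \<Psi> f \<alpha> q v = (1/2) *\<^sub>R (J_dir \<Psi> f q v + \<alpha> *\<^sub>R mat 1)"

definition J_minus :: "(real^'m \<Rightarrow> real^'m) \<Rightarrow> (2 \<Rightarrow> real^'m \<Rightarrow> real^'m) \<Rightarrow> real \<Rightarrow> real^2 \<Rightarrow>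
    real^'m \<Rightarrow> real^'m^'m" where
  "J_minus \<Psi> f \<alpha> q v = (1/2) *\<^sub>R (J_dir \<Psi> f q v - \<alpha> *\<^sub>R mat 1)"

definition D_pt_vertex :: "(real^'m \<Rightarrow> real^'m) \<Rightarrow> (2 \<Rightarrow> real^'m \<Rightarrow> real^'m) \<Rightarrow>
    'm discretization \<Rightarrow> 'm hybrid \<Rightarrow> node \<Rightarrow> real^'m" where
  "D_pt_vertex \<Psi> f D uh x = - (\<Sum>e\<in>edges_at (cells D) x. edge_weight D x e *\<^sub>R
     (let v = snd uh x; \<alpha> = visc D x; n = norml D x e; \<tau> = tang D x e in
        J_plus \<Psi> f \<alpha> n v *v dw \<Psi> D uh x e N_minus
      + J_minus \<Psi> f \<alpha> n v *v dw \<Psi> D uh x e N_plus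
      + J_minus \<Psi> f \<alpha> \<tau> v *v dw \<Psi> D uh x e T_minus
      + J_plus \<Psi> f \<alpha> \<tau> v *v dw \<Psi> D uh x e T_ext))"

definition D_pt_midpoint :: "(real^'m \<Rightarrow> real^'m) \<Rightarrow> (2 \<Rightarrow> real^'m \<Rightarrow> real^'m) \<Rightarrow>
    'm discretization \<Rightarrow> 'm hybrid \<Rightarrow> node \<Rightarrow> edge \<Rightarrow> real^'m" where
  "D_pt_midpoint \<Psi> f D uh x e =
     - (let v = snd uh x; \<alpha> = visc D x; n = norml D x e; \<tau> = tang D x e in
        J_plus \<Psi> f \<alpha> n v *v dw \<Psi> D uh x e N_minus
      + J_minus \<Psi> f \<alpha> n v *v dw \<Psi> D uh x e N_plus
      + J_dir \<Psi> f \<tau> v *v dw \<Psi> D uh x e T_minus)"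

definition D_pt :: "(real^'m \<Rightarrow> real^'m) \<Rightarrow> (2 \<Rightarrow> real^'m \<Rightarrow> real^'m) \<Rightarrow>
    'm discretization \<Rightarrow> 'm hybrid \<Rightarrow> node \<Rightarrow> real^'m" where
  "D_pt \<Psi> f D uh x =
     (if x \<in> mesh_vertices (cells D) then D_pt_vertex \<Psi> f D uh x
      else D_pt_midpoint \<Psi> f D uh x (SOME e. e \<in> mesh_edges (cells D) \<and> midpoint_of_edge x e))"

text \<open>Only the lower bound on \<open>visc\<close>. An upper bound uniform over a family of meshes is a separate
  requirement: \<open>visc\<close> multiplies jumps of one-sided derivatives, which are of size \<open>h ^ p\<close>.\<close>

definition viscosity_ok :: "(real^'m \<Rightarrow> real^'m) \<Rightarrow> (2 \<Rightarrow> real^'m \<Rightarrow> real^'m) \<Rightarrow>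
    'm discretization \<Rightarrow> 'm hybrid \<Rightarrow> node \<Rightarrow> bool" where
  "viscosity_ok \<Psi> f D uh x \<longleftrightarrow> visc D x > 0 \<and> (\<forall>e\<in>edges_at (cells D) x.
     spec_radius (J_dir \<Psi> f (norml D x e) (snd uh x)) \<le> visc D x \<and>
     spec_radius (J_dir \<Psi> f (tang D x e) (snd uh x)) \<le> visc D x)"


section \<open>Data from the exact solution\<close>

definition cell_average :: "cell \<Rightarrow> (real^2 \<Rightarrow> real^'m) \<Rightarrow> real^'m" where
  "cell_average K g = (1 / measure lebesgue K) *\<^sub>R integral K g"

definition exact_hybrid :: "(real^2 \<Rightarrow> real \<Rightarrow> real^'m) \<Rightarrow> real \<Rightarrow> 'm hybrid" where
  "exact_hybrid u t = (\<lambda>K. cell_average K (\<lambda>x. u x t), \<lambda>x. u x t)"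

definition reconstructs :: "cell set \<Rightarrow> cell \<Rightarrow> 'm hybrid \<Rightarrow> (real^2 \<Rightarrow> real^'m) \<Rightarrow> bool" where
  "reconstructs T K uh v \<longleftrightarrow> C1_on (closure K) v \<and> cell_average K v = fst uh K \<and>
     (\<forall>x \<in> mesh_nodes T \<inter> frontier K. v x = snd uh x)"

text \<open>\<open>\<Omega>\<close> only enters through the set within which the derivatives of \<open>u\<close> are taken.\<close>

definition reconstruction_accurate :: "(real^2) set \<Rightarrow> (real^2 \<Rightarrow> real \<Rightarrow> real^'m) \<Rightarrow> real \<Rightarrow>
    real \<Rightarrow> nat \<Rightarrow> real \<Rightarrow> cell \<Rightarrow> (real^2 \<Rightarrow> real^'m) \<Rightarrow> bool" where
  "reconstruction_accurate \<Omega> u t C p h K v \<longleftrightarrow>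
     Linf_norm (closure K) (\<lambda>x. v x - u x t) \<le> ereal (C * h ^ (p + 1)) \<and>
     Linf_norm (closure K) (\<lambda>x. jacobian v (at x within closure K)
                               - jacobian (\<lambda>y. u y t) (at x within closure \<Omega>))
       \<le> ereal (C * h ^ p)"

definition boundary_consistent :: "(real^2) set \<Rightarrow> (real^'m \<Rightarrow> real^'m) \<Rightarrow>
    (real^2 \<Rightarrow> real \<Rightarrow> real^'m) \<Rightarrow> real \<Rightarrow> real \<Rightarrow> nat \<Rightarrow> 'm discretization \<Rightarrow> node \<Rightarrow> bool" where
  "boundary_consistent \<Omega> \<Psi> u t C p D x \<longleftrightarrow>
     (\<forall>e\<in>edges_at (cells D) x. \<forall>s. slot_cell D x e s = None \<longrightarrow>
        norm (bdry D x e s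
              - jacobian (\<lambda>y. \<Psi> (u y t)) (at x within closure \<Omega>) *v slot_dir D x e s)
          \<le> C * mesh_size (cells D) ^ p)"

end

theory Submission
  imports Defs
begin

text \<open>The operator is built so that it is exact when every one-sided derivative is the exact
  directional derivative \<open>\<partial>\<^sub>q w = W q\<close>, where \<open>W\<close> is the spatial Jacobian of \<open>w\<close> at the node. In that
  case \<open>J\<^sup>+ + J\<^sup>- = J\<close> removes the viscosity edge by edge, and what is left on an edge with orthonormal
  frame \<open>(n, \<tau>)\<close> is \<open>J\<^sub>n \<partial>\<^sub>n w + J\<^sub>\<tau> \<partial>\<^sub>\<tau> w\<close>. This expression is quadratic in the frame and hence
  independent of it (\<open>J_dir_frame_invariance\<close>): it equals \<open>\<Sum>\<^sub>i J\<^sub>i \<partial>\<^sub>i w\<close> for every edge. The angle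
  weights form a convex combination (\<open>sum_edge_weight_eq_1\<close>), so the average over the edges at a
  vertex has the same value.

  The operator is linear in the one-sided derivatives, so its error is at most a constant times the
  largest error of a one-sided derivative (\<open>point_operator_error\<close>). The constant depends on a bound for
  the \<open>J\<^sub>i\<close>, which exists because \<open>u\<close> stays in a compact set (\<open>J_mat_bounded_on_compact\<close>), and on the
  bound for the viscosity. The error of a single derivative is \<open>D\<Psi>(u)\<close> applied to the error of the
  reconstructed gradient. Being an essential supremum, the assumed bound on that gradient says
  nothing directly about a node on the boundary of a cell; it is carried there by the
  continuity of both gradients (\<open>reconstruction_jacobian_error\<close>).

  The second estimate is the first one together with the equation for \<open>w\<close>, which is the chain rule
  applied to the system for \<open>u\<close> (\<open>transformed_equation\<close>).

  Derivatives at a node are taken within a closed cell or within the closure of the domain, and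
  \<open>jacobian\<close> is meaningful only if such derivatives are unique. They are, because the node is a
  closure point of an open convex cell (\<open>has_derivative_unique_within_convex\<close>).\<close>

section \<open>Derivatives relative to a convex cell\<close>

lemma norm_matrix_vector_mult_le:
  fixes A :: "real^'n^'m"
  shows "norm (A *v x) \<le> norm A * norm x"
proof -
  have "norm (A *v x) = L2_set (\<lambda>i. norm (A $ i \<bullet> x)) UNIV"
    by (simp add: norm_vec_def matrix_mult_dot)
  also have "\<dots> \<le> L2_set (\<lambda>i. norm (A $ i) * norm x) UNIV"
    by (rule L2_set_mono) (auto simp: Cauchy_Schwarz_ineq2)
  also have "\<dots> = norm A * norm x"
    by (simp add: norm_vec_def L2_set_left_distrib)
  finally show ?thesis .
qed

lemma convex_scaled_step_mem:
  fixes K :: "'a::euclidean_space set"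
  assumes "open K" "convex K" "x \<in> closure K" "x + d \<in> K" "0 < \<epsilon>" "\<epsilon> \<le> 1"
  shows "x + \<epsilon> *\<^sub>R d \<in> K"
  using mem_interior_closure_convex_shrink[of K "x + d" x \<epsilon>] assms
  by (simp add: interior_open)

text \<open>The cell contains the beginning of the ray from \<open>x\<close> towards each of its points, so two
  derivatives at \<open>x\<close> agree on all directions \<open>y - x\<close> with \<open>y \<in> K\<close>. These directions form a nonempty
  open set, on which a linear map is determined.\<close>

lemma has_derivative_unique_within_convex:
  fixes F :: "'a::euclidean_space \<Rightarrow> 'b::real_normed_vector"
  assumes K: "open K" "convex K" "K \<noteq> {}" "K \<subseteq> S" and x: "x \<in> closure K"
    and L: "(F has_derivative L) (at x within S)" and M: "(F has_derivative M) (at x within S)"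
  shows "L = M"
proof -
  interpret L: bounded_linear L using L by (rule has_derivative_bounded_linear)
  interpret M: bounded_linear M using M by (rule has_derivative_bounded_linear)
  have dir: "((\<lambda>\<epsilon>. F (x + \<epsilon> *\<^sub>R d)) has_vector_derivative D d) (at 0 within {0<..1})"
    if "x + d \<in> K" and D: "(F has_derivative D) (at x within S)" for d D
  proof -
    have lin: "linear D" using D by (rule has_derivative_linear)
    have sub: "(\<lambda>\<epsilon>. x + \<epsilon> *\<^sub>R d) ` {0<..1} \<subseteq> S"
      using convex_scaled_step_mem[OF K(1,2) x that(1)] K(4) by auto
    \<comment> \<open>The parameter \<open>0\<close> is left out of the interval: \<open>x\<close> itself need not belong to \<open>K\<close> or to \<open>S\<close>.\<close>
    have path: "((\<lambda>\<epsilon>::real. x + \<epsilon> *\<^sub>R d) has_derivative (\<lambda>\<epsilon>. \<epsilon> *\<^sub>R d)) (at 0 within {0<..1})"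
      by (auto intro!: derivative_eq_intros)
    have "(F has_derivative D) (at (x + 0 *\<^sub>R d) within (\<lambda>\<epsilon>. x + \<epsilon> *\<^sub>R d) ` {0<..1})"
      using has_derivative_subset[OF D sub] by simp
    from diff_chain_within[OF path this] show ?thesis
      by (simp add: has_vector_derivative_def o_def linear_scale[OF lin])
  qed
  have nb: "at (0::real) within {0<..1} \<noteq> bot"
    by (simp add: at_within_eq_bot_iff)
  have eq: "L d = M d" if "x + d \<in> K" for d
    using vector_derivative_unique_within[OF nb dir[OF that L] dir[OF that M]] .
  obtain y where y: "y \<in> K" using K(3) by blast
  obtain r where r: "r > 0" "ball y r \<subseteq> K" using K(1) y open_contains_ball by blast
  show ?thesis
  proof
    fix v :: 'a
    \<comment> \<open>Scaled so that \<open>c *\<^sub>R v\<close> is shorter than \<open>r\<close>, with the \<open>1\<close> covering \<open>v = 0\<close>.\<close>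
    define c where "c = r / (2 * (norm v + 1))"
    have c: "c > 0" using r by (simp add: c_def add_nonneg_pos)
    have "c * norm v < r"
    proof -
      have "norm v + 1 \<noteq> 0" using norm_ge_zero[of v] by linarith
      then have "c * (norm v + 1) = r / 2" by (simp add: c_def field_simps)
      then show ?thesis using r c by (simp add: distrib_left)
    qed
    then have "y + c *\<^sub>R v \<in> K"
      using r c by (auto simp: subset_iff dist_norm)
    then have "L ((y - x) + c *\<^sub>R v) = M ((y - x) + c *\<^sub>R v)"
      by (intro eq) (simp add: algebra_simps)
    moreover have "L (y - x) = M (y - x)" using y by (intro eq) simp
    ultimately show "L v = M v" using c by (simp add: L.add M.add L.scaleR M.scaleR)
  qed
qed

lemma jacobian_within_convex_eq:
  fixes F :: "real^'n \<Rightarrow> real^'m"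
  assumes K: "open K" "convex K" "K \<noteq> {}" "K \<subseteq> S" and x: "x \<in> closure K"
    and L: "(F has_derivative L) (at x within S)"
  shows "jacobian F (at x within S) = matrix L"
proof -
  have "(F has_derivative frechet_derivative F (at x within S)) (at x within S)"
    using L frechet_derivative_works differentiableI by blast
  then show ?thesis
    unfolding jacobian_def using has_derivative_unique_within_convex[OF K x _ L] by simp
qed

lemma jacobian_at_eq:
  fixes F :: "real^'n \<Rightarrow> real^'m"
  assumes "(F has_derivative L) (at x)"
  shows "jacobian F (at x) = matrix L"
  using assms frechet_derivative_at jacobian_def by metis

lemma continuous_on_matrix_blinfun:
  fixes F :: "'a::topological_space \<Rightarrow> ((real^'n) \<Rightarrow>\<^sub>L (real^'m))"
  assumes "continuous_on S F"
  shows "continuous_on S (\<lambda>x. matrix (blinfun_apply (F x)))"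
  unfolding matrix_def by (intro continuous_intros assms)

lemma C1_on_openD:
  fixes F :: "real^'n \<Rightarrow> real^'m"
  assumes "C1_on G F" "open G"
  shows "v \<in> G \<Longrightarrow> (F has_derivative (\<lambda>h. jacobian F (at v) *v h)) (at v)"
    and "continuous_on G (\<lambda>v. jacobian F (at v))"
proof -
  obtain F' where F': "\<And>v. v \<in> G \<Longrightarrow> (F has_derivative blinfun_apply (F' v)) (at v within G)"
    and cont: "continuous_on G F'"
    using assms(1) unfolding C1_on_def by blast
  have at: "(F has_derivative blinfun_apply (F' v)) (at v)" if "v \<in> G" for v
    using F'[OF that] at_within_open[OF that assms(2)] by simp
  show "v \<in> G \<Longrightarrow> (F has_derivative (\<lambda>h. jacobian F (at v) *v h)) (at v)"
    using at jacobian_works differentiableI by blast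
  show "continuous_on G (\<lambda>v. jacobian F (at v))"
    using continuous_on_matrix_blinfun[OF cont] jacobian_at_eq[OF at]
    by (simp cong: continuous_on_cong)
qed

section \<open>From essential to pointwise bounds\<close>

text \<open>The points of \<open>K\<close> at which the bound fails form an open null set, which is empty; continuity
  extends the bound from \<open>K\<close> to its closure, and in particular to the nodes, which all lie on the
  boundary of the cells.\<close>

lemma esssup_le_imp_le_on_closure:
  fixes g :: "'a::euclidean_space \<Rightarrow> real"
  assumes K: "open K" and cont: "continuous_on (closure K) g"
    and ess: "esssup (lebesgue_on (closure K)) (\<lambda>x. ereal (g x)) \<le> ereal c"
    and x: "x \<in> closure K"
  shows "g x \<le> c"
proof -
  have opn: "open {x \<in> K. c < g x}"
    using continuous_open_preimage[OF continuous_on_subset[OF cont closure_subset] K open_greaterThan[of c]]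
    by (simp add: vimage_def Collect_conj_eq)
  then have meas: "{x \<in> K. c < g x} \<in> sets lebesgue" by (simp add: borel_open)
  have "AE x in lebesgue_on (closure K). g x \<le> c"
    using esssup_AE[of "\<lambda>x. ereal (g x)" "lebesgue_on (closure K)"]
  proof eventually_elim
    case (elim x)
    then have "ereal (g x) \<le> ereal c" using ess by (rule order_trans)
    then show ?case by simp
  qed
  then have "AE x in lebesgue. x \<in> closure K \<longrightarrow> g x \<le> c"
    by (subst (asm) AE_restrict_space_iff) auto
  then have "AE x in lebesgue. x \<notin> {x \<in> K. c < g x}"
    by eventually_elim (use closure_subset in fastforce)
  then have neg: "negligible {x \<in> K. c < g x}"
    unfolding negligible_iff_null_sets AE_iff_null_sets[OF meas] .
  have "{x \<in> K. c < g x} = {}" using neg opn open_not_negligible by blast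
  then have "\<And>x. x \<in> K \<Longrightarrow> g x \<le> c" by force
  then show ?thesis using continuous_le_on_closure[OF cont x] by blast
qed

section \<open>Geometry of a cell at a node\<close>

lemma eventually_ray_mem_iff:
  fixes K :: "'a::euclidean_space set"
  assumes "open K" "convex K" "x \<in> closure K"
  shows "(\<forall>\<^sub>F \<epsilon> in at_right 0. x + \<epsilon> *\<^sub>R d \<in> K) \<longleftrightarrow> (\<exists>\<epsilon>>0. x + \<epsilon> *\<^sub>R d \<in> K)"
proof
  assume "\<forall>\<^sub>F \<epsilon> in at_right 0. x + \<epsilon> *\<^sub>R d \<in> K"
  then obtain b where "b > 0" "\<forall>y>0. y < b \<longrightarrow> x + y *\<^sub>R d \<in> K"
    unfolding eventually_at_right_field by blast
  then have "x + (b/2) *\<^sub>R d \<in> K" by simp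
  with \<open>b > 0\<close> show "\<exists>\<epsilon>>0. x + \<epsilon> *\<^sub>R d \<in> K" by (intro exI[of _ "b/2"]) auto
next
  assume "\<exists>\<epsilon>>0. x + \<epsilon> *\<^sub>R d \<in> K"
  then obtain b where b: "b > 0" "x + b *\<^sub>R d \<in> K" by blast
  have "x + \<epsilon> *\<^sub>R d \<in> K" if "0 < \<epsilon>" "\<epsilon> < b" for \<epsilon>
    using convex_scaled_step_mem[OF assms b(2), of "\<epsilon> / b"] that b(1) by simp
  with b(1) show "\<forall>\<^sub>F \<epsilon> in at_right 0. x + \<epsilon> *\<^sub>R d \<in> K"
    unfolding eventually_at_right_field by blast
qed

text \<open>The angles of rays into \<open>K\<close> form an open set of parameters. It meets \<open>[0, 2\<pi>)\<close>, and since that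
  interval is open to the right the intersection contains a nondegenerate interval \<open>(\<phi>, b)\<close>, even when
  \<open>\<phi> = 0\<close>. Openness also supplies the measurability without which \<open>measure\<close> would be \<open>0\<close>.\<close>

lemma interior_angle_pos:
  assumes K: "open K" "convex K" "K \<noteq> {}" and x: "x \<in> closure K"
  shows "interior_angle K x > 0"
proof -
  define S where "S = {\<phi>. \<exists>\<epsilon>>0. x + \<epsilon> *\<^sub>R vector [cos \<phi>, sin \<phi>] \<in> K}"
  have angle: "interior_angle K x = measure lborel ({0..<2 * pi} \<inter> S)"
    unfolding interior_angle_def S_def eventually_ray_mem_iff[OF K(1,2) x]
    by (rule arg_cong[where f = "measure lborel"]) auto
  have cont: "continuous_on UNIV (\<lambda>\<phi>::real. vector [cos \<phi>, sin \<phi>] :: real^2)"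
  proof -
    have eq: "(\<lambda>\<phi>::real. vector [cos \<phi>, sin \<phi>] :: real^2) = (\<lambda>\<phi>. \<chi> i. if i = 1 then cos \<phi> else sin \<phi>)"
      by (simp add: fun_eq_iff vec_eq_iff forall_2)
    have "continuous_on UNIV (\<lambda>\<phi>::real. if i = 1 then cos \<phi> else sin \<phi>)" for i :: 2
      by (cases "i = 1") (auto intro!: continuous_intros)
    then show ?thesis unfolding eq by (intro continuous_on_vec_lambda)
  qed
  have "S = (\<Union>\<epsilon>\<in>{0<..}. (\<lambda>\<phi>. x + \<epsilon> *\<^sub>R vector [cos \<phi>, sin \<phi>]) -` K)"
    unfolding S_def by auto
  moreover have "open ((\<lambda>\<phi>. x + \<epsilon> *\<^sub>R vector [cos \<phi>, sin \<phi>] :: real^2) -` K)" for \<epsilon> :: real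
    by (intro open_vimage K(1) continuous_intros cont)
  ultimately have S: "open S" by auto
  have "K \<noteq> {x}" using K(1) not_open_singleton by metis
  then obtain y where y: "y \<in> K" "y \<noteq> x" using K(3) by blast
  define r where "r = norm (y - x)"
  have r: "r > 0" using y by (simp add: r_def)
  have "(y - x) \<bullet> (y - x) = r\<^sup>2" by (simp add: r_def power2_norm_eq_inner)
  then have "((y - x) $ 1)\<^sup>2 + ((y - x) $ 2)\<^sup>2 = r\<^sup>2"
    by (simp add: inner_vec_def sum_2 power2_eq_square)
  then have "((y - x) $ 1 / r)\<^sup>2 + ((y - x) $ 2 / r)\<^sup>2 = 1"
    using r by (simp add: power_divide flip: add_divide_distrib)
  then obtain \<phi> where \<phi>: "0 \<le> \<phi>" "\<phi> < 2 * pi" "(y - x) $ 1 / r = cos \<phi>" "(y - x) $ 2 / r = sin \<phi>"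
    using sincos_total_2pi by metis
  have "x + r *\<^sub>R vector [cos \<phi>, sin \<phi>] = y"
    using r by (simp add: vec_eq_iff forall_2 flip: \<phi>(3,4))
  then have "\<phi> \<in> S" using r y unfolding S_def by force
  then obtain e where e: "e > 0" "ball \<phi> e \<subseteq> S" using S open_contains_ball by blast
  define b where "b = min (\<phi> + e) (2 * pi)"
  have b: "\<phi> < b" using e \<phi> by (simp add: b_def)
  have "{\<phi><..<b} \<subseteq> {0..<2 * pi} \<inter> S"
    using e(2) \<phi>(1) by (auto simp: b_def subset_iff dist_real_def)
  moreover have "{0..<2 * pi} \<inter> S \<in> fmeasurable lborel"
    by (rule fmeasurableI2[of "{0..2*pi}"]) (auto simp: fmeasurable_def S)
  ultimately have "measure lborel {\<phi><..<b} \<le> measure lborel ({0..<2 * pi} \<inter> S)"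
    by (intro measure_mono_fmeasurable) auto
  then show ?thesis using b by (simp add: angle)
qed

lemma ex_edge_of_polygon_vertex:
  fixes K :: "(real^2) set"
  assumes K: "open K" "convex K" "K \<noteq> {}" "polytope (closure K)" and v: "v extreme_point_of closure K"
  obtains e where "e edge_of closure K" "v \<in> e"
proof -
  have dim: "aff_dim K = 2"
    using aff_dim_open[OF K(1,3)] by simp
  have "v \<notin> interior (closure K)" using v extreme_point_not_in_interior by blast
  moreover have "rel_interior (closure K) = interior (closure K)"
    using K(1,3) convex_interior_closure[OF K(2)] by (intro rel_interior_nonempty_interior) (simp add: interior_open)
  ultimately have "v \<in> rel_frontier (closure K)"
    using v by (simp add: rel_frontier_def extreme_point_of_def)
  then obtain F where F: "F facet_of closure K" "v \<in> F"
    using rel_frontier_of_polyhedron[OF polytope_imp_polyhedron[OF K(4)]] by blast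
  then have "F edge_of closure K" by (simp add: facet_of_def edge_of_def dim)
  then show thesis using F(2) that by blast
qed

lemma norm_normal_of [simp]: "norm (normal_of \<tau>) = norm \<tau>"
  by (simp add: norm_vec_def L2_set_def sum_2 normal_of_def add.commute)

text \<open>The line through \<open>x\<close> in direction \<open>\<tau>\<close> is contained in the affine hull of the edge, and this hull
  misses the interior of the cell since the edge is a proper face. A connected set that misses the
  line lies on one side of it.\<close>

lemma cell_on_one_side_of_edge:
  assumes K: "open K" "convex K" "K \<noteq> {}" and e: "e edge_of closure K" "x \<in> e"
    and \<tau>: "unit_tangent x e \<tau>"
  shows "(\<forall>y\<in>K. normal_of \<tau> \<bullet> (y - x) > 0) \<or> (\<forall>y\<in>K. - normal_of \<tau> \<bullet> (y - x) > 0)"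
proof -
  obtain s where s: "s > 0" "x + s *\<^sub>R \<tau> \<in> e" and n1: "norm \<tau> = 1"
    using \<tau> unfolding unit_tangent_def by blast
  have face: "e face_of closure K" "aff_dim e = 1" using e(1) by (auto simp: edge_of_def)
  have "aff_dim (closure K) = 2" using aff_dim_open[OF K(1,3)] by simp
  then have "e \<noteq> closure K" using face by auto
  then have disj: "affine hull e \<inter> rel_interior (closure K) = {}"
    using affine_hull_face_of_disjoint_rel_interior[OF convex_closure[OF K(2)] face(1)] by blast
  have Kint: "K \<subseteq> rel_interior (closure K)"
    using K(1) closure_subset interior_maximal interior_subset_rel_interior by (metis order_trans)
  have nz: "normal_of \<tau> \<bullet> (y - x) \<noteq> 0" if "y \<in> K" for y
  proof
    assume 0: "normal_of \<tau> \<bullet> (y - x) = 0"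
    \<comment> \<open>Orthogonal to the normal, \<open>y - x\<close> is the multiple \<open>c\<close> of \<open>\<tau>\<close>.\<close>
    have t: "(\<tau> $ 1)\<^sup>2 + (\<tau> $ 2)\<^sup>2 = 1"
      using n1 by (simp add: norm_vec_def L2_set_def sum_2)
    have eq0: "\<tau> $ 2 * (y $ 1 - x $ 1) = \<tau> $ 1 * (y $ 2 - x $ 2)"
      using 0 by (simp add: normal_of_def inner_vec_def sum_2)
    define c where "c = \<tau> \<bullet> (y - x)"
    have c: "c = \<tau> $ 1 * (y $ 1 - x $ 1) + \<tau> $ 2 * (y $ 2 - x $ 2)"
      by (simp add: c_def inner_vec_def sum_2)
    have "c * \<tau> $ 1 = y $ 1 - x $ 1" "c * \<tau> $ 2 = y $ 2 - x $ 2"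
      using eq0 t unfolding c by algebra+
    then have "y = x + c *\<^sub>R \<tau>" by (simp add: vec_eq_iff forall_2)
    also have "\<dots> = (1 - c / s) *\<^sub>R x + (c / s) *\<^sub>R (x + s *\<^sub>R \<tau>)"
      using s(1) by (simp add: algebra_simps)
    also have "\<dots> \<in> affine hull e"
      by (rule mem_affine[OF affine_affine_hull]) (auto intro: hull_inc s(2) e(2))
    finally show False using disj Kint that by blast
  qed
  show ?thesis
  proof (rule ccontr)
    assume "\<not> ?thesis"
    then obtain y z where yz: "y \<in> K" "z \<in> K" "normal_of \<tau> \<bullet> (y - x) \<le> 0" "normal_of \<tau> \<bullet> (z - x) \<ge> 0"
      by (force simp: not_less)
    have "connected ((\<lambda>y. normal_of \<tau> \<bullet> (y - x)) ` K)"
      by (intro connected_continuous_image continuous_intros convex_connected K(2))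
    then have "0 \<in> (\<lambda>y. normal_of \<tau> \<bullet> (y - x)) ` K"
      using yz unfolding connected_iff_interval by blast
    then show False using nz by force
  qed
qed

section \<open>Angle weights\<close>

lemma side_cell_SomeD:
  assumes "side_cell T x e d = Some K"
  shows "K \<in> T" "e edge_of closure K"
proof -
  let ?P = "\<lambda>K. K \<in> T \<and> e edge_of closure K \<and> (\<forall>y\<in>K. d \<bullet> (y - x) > 0)"
  have "\<exists>K. ?P K" "K = (SOME K. ?P K)"
    using assms by (auto simp: side_cell_def Let_def split: if_splits)
  then have "?P K" using someI_ex[of ?P] by simp
  then show "K \<in> T" "e edge_of closure K" by simp_all
qed

lemma side_cell_eq_NoneD:
  assumes "side_cell T x e d = None" "K \<in> T" "e edge_of closure K"
  shows "\<not> (\<forall>y\<in>K. d \<bullet> (y - x) > 0)"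
  using assms by (auto simp: side_cell_def Let_def split: if_splits)

lemma finite_edges_at:
  assumes "mesh_of \<Omega> T"
  shows "finite (edges_at T x)"
proof -
  have "edges_at T x \<subseteq> (\<Union>K\<in>T. {F. F face_of closure K})"
    by (auto simp: edges_at_def mesh_edges_def edge_of_def)
  moreover have "finite (\<Union>K\<in>T. {F. F face_of closure K})"
    using assms by (auto simp: mesh_of_def finite_polytope_faces)
  ultimately show ?thesis by (rule finite_subset)
qed

lemma edge_angle_nonneg: "0 \<le> edge_angle D x e"
  by (auto simp: edge_angle_def interior_angle_def split: option.split)

lemma edge_weight_nonneg: "0 \<le> edge_weight D x e"
  by (simp add: edge_weight_def edge_angle_nonneg sum_nonneg)

lemma interior_angle_adjacent_pos:
  assumes "mesh_of \<Omega> T" "side_cell T x e d = Some K" "x \<in> e"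
  shows "interior_angle K x > 0"
  using side_cell_SomeD[OF assms(2)] assms(1,3)
  by (intro interior_angle_pos) (auto simp: mesh_of_def edge_of_def dest: face_of_imp_subset)

text \<open>This excludes the degenerate case of a vanishing sum of angles, in which the convention
  \<open>x / 0 = 0\<close> would make all weights \<open>0\<close>. An edge at \<open>x\<close> of a cell that has \<open>x\<close> as a corner has that cell
  on one of its sides; the choice in \<open>side_cell\<close> may return another cell there, but
  any adjacent cell contributes a positive angle.\<close>

lemma ex_edge_angle_pos:
  assumes mesh: "mesh_of \<Omega> (cells D)" and ori: "well_oriented D" and x: "x \<in> mesh_vertices (cells D)"
  shows "\<exists>e\<in>edges_at (cells D) x. edge_angle D x e > 0"
proof -
  obtain K where K: "K \<in> cells D" "x extreme_point_of closure K"
    using x by (auto simp: mesh_vertices_def)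
  then have K': "open K" "convex K" "K \<noteq> {}" "polytope (closure K)"
    using mesh by (auto simp: mesh_of_def)
  obtain e where e: "e edge_of closure K" "x \<in> e"
    using ex_edge_of_polygon_vertex[OF K' K(2)] .
  have e_at: "e \<in> edges_at (cells D) x" using e K(1) by (auto simp: edges_at_def mesh_edges_def)
  have "unit_tangent x e (tang D x e)"
    using ori x e_at by (auto simp: well_oriented_def mesh_nodes_def)
  from cell_on_one_side_of_edge[OF K'(1-3) e this]
  have "K_plus D x e \<noteq> None \<or> K_minus D x e \<noteq> None"
    using side_cell_eq_NoneD[OF _ K(1) e(1)] unfolding K_plus_def K_minus_def norml_def by blast
  moreover have "interior_angle L x > 0" if "K_plus D x e = Some L \<or> K_minus D x e = Some L" for L
    using that interior_angle_adjacent_pos[OF mesh _ e(2)] unfolding K_plus_def K_minus_def by blast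
  ultimately have "edge_angle D x e > 0"
    by (force simp: edge_angle_def add_pos_nonneg add_nonneg_pos interior_angle_def split: option.split)
  with e_at show ?thesis by blast
qed

lemma sum_edge_weight_eq_1:
  assumes "mesh_of \<Omega> (cells D)" "well_oriented D" "x \<in> mesh_vertices (cells D)"
  shows "(\<Sum>e\<in>edges_at (cells D) x. edge_weight D x e) = 1"
proof -
  have "(\<Sum>e\<in>edges_at (cells D) x. edge_angle D x e) > 0"
    using ex_edge_angle_pos[OF assms] finite_edges_at[OF assms(1)] edge_angle_nonneg
    by (metis sum_pos2)
  then show ?thesis by (simp add: edge_weight_def flip: sum_divide_distrib)
qed

section \<open>Bounds on compact sets\<close>

lemma bounded_on_compact:
  fixes A :: "'a::topological_space \<Rightarrow> 'b::real_normed_vector"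
  assumes "compact S" "continuous_on S A"
  obtains B where "B > 0" "\<And>v. v \<in> S \<Longrightarrow> norm (A v) \<le> B"
  using compact_imp_bounded[OF compact_continuous_image[OF assms(2,1)]] by (auto simp: bounded_pos)

lemma matrix_inv_mult:
  fixes A :: "real^'n^'n"
  assumes "invertible A"
  shows "A ** matrix_inv A = mat 1" "matrix_inv A ** A = mat 1"
proof -
  have "A ** matrix_inv A = mat 1 \<and> matrix_inv A ** A = mat 1"
    unfolding matrix_inv_def by (rule someI_ex) (use assms in \<open>simp add: invertible_def\<close>)
  then show "A ** matrix_inv A = mat 1" "matrix_inv A ** A = mat 1" by auto
qed

text \<open>On the product of \<open>S\<close> with the unit sphere, \<open>norm (A v *v x)\<close> attains a minimum \<open>c\<close>, which is
  positive by invertibility. Hence \<open>c * norm x \<le> norm (A v *v x)\<close>, which bounds the inverse by \<open>1 / c\<close>.\<close>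

lemma matrix_inv_bounded_on_compact:
  fixes A :: "'a::metric_space \<Rightarrow> real^'n^'n"
  assumes S: "compact S" and cont: "continuous_on S A" and inv: "\<And>v. v \<in> S \<Longrightarrow> invertible (A v)"
  obtains B where "B > 0" "\<And>v y. v \<in> S \<Longrightarrow> norm (matrix_inv (A v) *v y) \<le> B * norm y"
proof (cases "S = {}")
  case True
  show ?thesis using that[of 1] True by auto
next
  case False
  let ?X = "S \<times> sphere (0 :: real^'n) 1"
  let ?g = "\<lambda>z. norm (A (fst z) *v snd z)"
  have "continuous_on ?X (\<lambda>z. A (fst z))"
    by (rule continuous_on_compose2[OF cont]) (auto intro: continuous_on_fst continuous_on_id)
  then have "continuous_on ?X (\<lambda>z. A (fst z) $ i $ j)" for i j
    by (intro continuous_on_component)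
  moreover have "continuous_on ?X (\<lambda>z. snd z $ j)" for j
    by (intro continuous_on_component continuous_on_snd continuous_on_id)
  ultimately have "continuous_on ?X ?g"
    unfolding matrix_vector_mult_def
    by (intro continuous_on_norm continuous_on_vec_lambda continuous_on_sum continuous_on_mult)
  moreover have "compact ?X" "?X \<noteq> {}" using S False by (auto intro: compact_Times)
  ultimately obtain z where z: "z \<in> ?X" and min: "\<forall>z'\<in>?X. ?g z \<le> ?g z'"
    using continuous_attains_inf[of ?X ?g] by fast
  define c where "c = ?g z"
  have "matrix_inv (A (fst z)) *v (A (fst z) *v snd z) = snd z"
    using z inv by (simp add: matrix_vector_mul_assoc matrix_inv_mult mem_Times_iff)
  moreover have "snd z \<noteq> 0" using z by auto
  ultimately have "A (fst z) *v snd z \<noteq> 0" by (metis matrix_vector_mult_0_right)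
  then have c: "c > 0" by (simp add: c_def)
  have "norm (matrix_inv (A v) *v y) \<le> (1 / c) * norm y" if v: "v \<in> S" for v y
  proof (cases "matrix_inv (A v) *v y = 0")
    case False
    define x where "x = matrix_inv (A v) *v y"
    have x: "x \<noteq> 0" using False by (simp add: x_def)
    have y: "A v *v x = y"
      using inv[OF v] by (simp add: x_def matrix_vector_mul_assoc matrix_inv_mult)
    have "c \<le> ?g (v, x /\<^sub>R norm x)" unfolding c_def by (rule bspec[OF min]) (use v x in auto)
    also have "\<dots> = norm y / norm x"
      using y by (simp add: matrix_vector_mult_scaleR divide_inverse mult.commute)
    finally have "c * norm x \<le> norm y" using x by (simp add: field_simps)
    then show ?thesis using c by (simp add: field_simps flip: x_def)
  qed (use c in auto)
  with c show ?thesis by (intro that[of "1 / c"]) auto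
qed

lemma J_mat_bounded_on_compact:
  fixes \<Psi> :: "real^'m \<Rightarrow> real^'m"
  assumes G: "open G" "\<And>i. C1_on G (f i)" "change_of_variables G \<Psi>" and S: "compact S" "S \<subseteq> G"
  obtains B where "B > 0" "\<And>i v y. v \<in> S \<Longrightarrow> norm (J_mat \<Psi> f i v *v y) \<le> B * norm y"
proof -
  have \<Psi>: "C1_on G \<Psi>" "\<And>v. v \<in> G \<Longrightarrow> invertible (jacobian \<Psi> (at v))"
    using G(3) by (auto simp: change_of_variables_def)
  have \<Psi>': "continuous_on S (\<lambda>v. jacobian \<Psi> (at v))"
    by (rule continuous_on_subset[OF C1_on_openD(2)[OF \<Psi>(1) G(1)] S(2)])
  have f': "continuous_on S (\<lambda>v. jacobian (f i) (at v))" for i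
    by (rule continuous_on_subset[OF C1_on_openD(2)[OF G(2,1)] S(2)])
  obtain M where M: "M > 0" "\<And>v. v \<in> S \<Longrightarrow> norm (jacobian \<Psi> (at v)) \<le> M"
    using bounded_on_compact[OF S(1) \<Psi>'] by blast
  obtain L where L: "L > 0" "\<And>v y. v \<in> S \<Longrightarrow> norm (matrix_inv (jacobian \<Psi> (at v)) *v y) \<le> L * norm y"
    using matrix_inv_bounded_on_compact[OF S(1) \<Psi>'] \<Psi>(2) S(2) by blast
  obtain A1 where A1: "A1 > 0" "\<And>v. v \<in> S \<Longrightarrow> norm (jacobian (f 1) (at v)) \<le> A1"
    using bounded_on_compact[OF S(1) f'] by blast
  obtain A2 where A2: "A2 > 0" "\<And>v. v \<in> S \<Longrightarrow> norm (jacobian (f 2) (at v)) \<le> A2"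
    using bounded_on_compact[OF S(1) f'] by blast
  have A: "norm (jacobian (f i) (at v)) \<le> A1 + A2" if "v \<in> S" for i v
    using A1(1) A2(1) A1(2)[OF that] A2(2)[OF that] exhaust_2[of i] by auto
  have "norm (J_mat \<Psi> f i v *v y) \<le> M * ((A1 + A2) * L) * norm y" if v: "v \<in> S" for i v y
  proof -
    have step: "norm (X *v z) \<le> b * c" if "norm X \<le> b" "norm z \<le> c" for X :: "real^'m^'m" and z b c
      using order_trans[OF norm_matrix_vector_mult_le mult_mono'[OF that]] by simp
    have "norm (jacobian \<Psi> (at v) *v (jacobian (f i) (at v) *v (matrix_inv (jacobian \<Psi> (at v)) *v y)))
        \<le> M * ((A1 + A2) * (L * norm y))"
      by (intro step M A L v)
    then show ?thesis by (simp add: J_mat_def matrix_vector_mul_assoc matrix_mul_assoc mult.assoc)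
  qed
  moreover have "M * ((A1 + A2) * L) > 0" using M(1) A1(1) A2(1) L(1) by simp
  ultimately show thesis by (rule that[rotated])
qed

section \<open>The upwind splitting\<close>

lemma J_plus_add_J_minus:
  "J_plus \<Psi> f \<alpha> q v *v y + J_minus \<Psi> f \<alpha> q v *v y = J_dir \<Psi> f q v *v y"
  by (simp add: J_plus_def J_minus_def algebra_simps matrix_vector_mult_add_rdistrib
      matrix_vector_mult_diff_rdistrib scaleR_matrix_vector_assoc[symmetric] flip: scaleR_left_distrib)

lemma J_dir_mult:
  "J_dir \<Psi> f q v *v y = (\<Sum>i\<in>UNIV. (q $ i) *\<^sub>R (J_mat \<Psi> f i v *v y))"
  by (simp add: J_dir_def sum_2 matrix_vector_mult_add_rdistrib scaleR_matrix_vector_assoc[symmetric])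

lemma matrix_vector_mult_2:
  fixes W :: "real^2^'m"
  shows "W *v q = (q $ 1) *\<^sub>R (W *v axis 1 1) + (q $ 2) *\<^sub>R (W *v axis 2 1)"
proof -
  have "q = (q $ 1) *\<^sub>R axis 1 1 + (q $ 2) *\<^sub>R axis 2 1"
    by (simp add: vec_eq_iff forall_2 axis_def)
  then have "W *v q = W *v ((q $ 1) *\<^sub>R axis 1 1 + (q $ 2) *\<^sub>R axis 2 1)"
    by (rule arg_cong)
  then show ?thesis
    by (simp only: matrix_vector_mult_scaleR matrix_vector_right_distrib)
qed

text \<open>\<open>J\<^sub>q W q = \<Sum>\<^sub>i\<^sub>j q\<^sub>i q\<^sub>j J\<^sub>i W\<^sub>j\<close> is a quadratic form in \<open>q\<close> with vector values, and summing it
  over an orthonormal basis gives its trace. With \<open>\<tau> = (a, b)\<close> and \<open>n = (b, -a)\<close> the mixed terms cancel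
  and the diagonal ones carry the factor \<open>a\<^sup>2 + b\<^sup>2\<close>.\<close>

lemma J_dir_frame_invariance:
  fixes W :: "real^2^'m"
  assumes "norm \<tau> = 1"
  shows "J_dir \<Psi> f (normal_of \<tau>) v *v (W *v normal_of \<tau>) + J_dir \<Psi> f \<tau> v *v (W *v \<tau>)
       = (\<Sum>i\<in>UNIV. J_mat \<Psi> f i v *v (W *v axis i 1))"
proof -
  let ?a = "\<lambda>i j. J_mat \<Psi> f i v *v (W *v axis j 1)"
  define a where "a = \<tau> $ 1"
  define b where "b = \<tau> $ 2"
  have n: "normal_of \<tau> $ 1 = b" "normal_of \<tau> $ 2 = - a" by (auto simp: normal_of_def a_def b_def)
  have ab: "a * a + b * b = 1"
    using assms by (simp add: norm_vec_def L2_set_def sum_2 power2_eq_square a_def b_def)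
  have J: "J_dir \<Psi> f q v *v (W *v q) = (q$1 * q$1) *\<^sub>R ?a 1 1 + (q$1 * q$2) *\<^sub>R ?a 1 2
      + (q$2 * q$1) *\<^sub>R ?a 2 1 + (q$2 * q$2) *\<^sub>R ?a 2 2" for q
    by (simp add: J_dir_mult matrix_vector_mult_2[of W q] sum_2 algebra_simps matrix_vector_mult_scaleR
        matrix_vector_right_distrib)
  have "J_dir \<Psi> f (normal_of \<tau>) v *v (W *v normal_of \<tau>) + J_dir \<Psi> f \<tau> v *v (W *v \<tau>)
      = (a * a + b * b) *\<^sub>R ?a 1 1 + (a * a + b * b) *\<^sub>R ?a 2 2"
    unfolding J n by (simp add: algebra_simps flip: a_def b_def)
  then show ?thesis by (simp add: ab sum_2)
qed

lemma norm_J_dir_le: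
  assumes B: "\<And>i y. norm (J_mat \<Psi> f i v *v y) \<le> B * norm y" and q: "norm q = 1"
  shows "norm (J_dir \<Psi> f q v *v y) \<le> 2 * B * norm y"
proof -
  have "norm ((q $ i) *\<^sub>R (J_mat \<Psi> f i v *v y)) \<le> 1 * (B * norm y)" for i
    unfolding norm_scaleR
    using component_le_norm_cart[of q i] q B[of i y] by (intro mult_mono) auto
  from this[of 1] this[of 2] show ?thesis
    unfolding J_dir_mult sum_2 by (intro order_trans[OF norm_triangle_ineq]) simp
qed

lemma norm_J_split_le:
  assumes B: "\<And>i y. norm (J_mat \<Psi> f i v *v y) \<le> B * norm y" and q: "norm q = 1" and \<alpha>: "0 \<le> \<alpha>"
  shows "norm (J_plus \<Psi> f \<alpha> q v *v y) \<le> (B + \<alpha>) * norm y"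
    and "norm (J_minus \<Psi> f \<alpha> q v *v y) \<le> (B + \<alpha>) * norm y"
proof -
  have J: "norm (J_dir \<Psi> f q v *v y) \<le> 2 * B * norm y" by (rule norm_J_dir_le[OF B q])
  have p: "J_plus \<Psi> f \<alpha> q v *v y = (1/2) *\<^sub>R (J_dir \<Psi> f q v *v y + \<alpha> *\<^sub>R y)"
    by (simp add: J_plus_def matrix_vector_mult_add_rdistrib scaleR_matrix_vector_assoc[symmetric])
  have m: "J_minus \<Psi> f \<alpha> q v *v y = (1/2) *\<^sub>R (J_dir \<Psi> f q v *v y - \<alpha> *\<^sub>R y)"
    by (simp add: J_minus_def matrix_vector_mult_diff_rdistrib scaleR_matrix_vector_assoc[symmetric])
  have \<alpha>y: "0 \<le> \<alpha> * norm y" "norm (\<alpha> *\<^sub>R y) = \<alpha> * norm y" using \<alpha> by simp_all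
  show "norm (J_plus \<Psi> f \<alpha> q v *v y) \<le> (B + \<alpha>) * norm y"
    unfolding p norm_scaleR distrib_right
    using J \<alpha>y norm_triangle_ineq[of "J_dir \<Psi> f q v *v y" "\<alpha> *\<^sub>R y"] by simp
  show "norm (J_minus \<Psi> f \<alpha> q v *v y) \<le> (B + \<alpha>) * norm y"
    unfolding m norm_scaleR distrib_right
    using J \<alpha>y norm_triangle_ineq4[of "J_dir \<Psi> f q v *v y" "\<alpha> *\<^sub>R y"] by simp
qed

section \<open>The exact solution\<close>

text \<open>The solution is differentiable within a space-time set that is relatively open in the closure
  of the domain times the time axis. Near a point of that set a spatial slice is all of the closure
  of the domain, and a time slice is a full interval, which gives the two partial derivatives.\<close>

lemma space_time_derivatives:
  fixes u :: "real^2 \<Rightarrow> real \<Rightarrow> real^'m"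
  assumes Q: "openin (top_of_set (closure \<Omega> \<times> UNIV)) Q" and u: "C1_on Q (\<lambda>(x, t). u x t)"
  obtains F :: "(real^2) \<times> real \<Rightarrow> ((real^2) \<times> real) \<Rightarrow>\<^sub>L (real^'m)" where "continuous_on Q F"
    "\<And>x t. (x, t) \<in> Q \<Longrightarrow>
       ((\<lambda>y. u y t) has_derivative (\<lambda>d. blinfun_apply (F (x, t)) (d, 0))) (at x within closure \<Omega>)"
    "\<And>x t. (x, t) \<in> Q \<Longrightarrow> ((\<lambda>s. u x s) has_vector_derivative F (x, t) (0, 1)) (at t)"
proof -
  obtain F where F: "\<And>z. z \<in> Q \<Longrightarrow> ((\<lambda>(x, t). u x t) has_derivative blinfun_apply (F z)) (at z within Q)"
    and cont: "continuous_on Q F"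
    using u unfolding C1_on_def by blast
  obtain V where V: "open V" "Q = (closure \<Omega> \<times> UNIV) \<inter> V"
    using Q unfolding openin_open by blast
  have space: "((\<lambda>y. u y t) has_derivative (\<lambda>d. blinfun_apply (F (x, t)) (d, 0))) (at x within closure \<Omega>)"
    if "(x, t) \<in> Q" for x t
  proof -
    define U where "U = (\<lambda>y. (y, t)) -` V"
    have U: "open U" "x \<in> U"
      unfolding U_def using V that by (auto intro!: open_vimage continuous_intros)
    have path: "((\<lambda>y. (y, t)) has_derivative (\<lambda>d. (d, 0))) (at x within closure \<Omega> \<inter> U)"
      by (rule has_derivative_Pair[OF has_derivative_ident has_derivative_const])
    have "(\<lambda>y. (y, t)) ` (closure \<Omega> \<inter> U) \<subseteq> Q" using V by (auto simp: U_def)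
    from diff_chain_within[OF path has_derivative_subset[OF F[OF that] this]]
    have "((\<lambda>y. u y t) has_derivative (\<lambda>d. blinfun_apply (F (x, t)) (d, 0))) (at x within closure \<Omega> \<inter> U)"
      by (simp add: o_def)
    moreover have "at x within closure \<Omega> \<inter> U = at x within closure \<Omega>"
      by (rule at_within_nhd[OF U(2,1)]) auto
    ultimately show ?thesis by simp
  qed
  have time: "((\<lambda>s. u x s) has_vector_derivative F (x, t) (0, 1)) (at t)" if "(x, t) \<in> Q" for x t
  proof -
    define U where "U = (\<lambda>s. (x, s)) -` V"
    have U: "open U" "t \<in> U"
      unfolding U_def using V that by (auto intro!: open_vimage continuous_intros)
    have path: "((\<lambda>s. (x, s)) has_derivative (\<lambda>d. (0, d))) (at t within U)"
      by (rule has_derivative_Pair[OF has_derivative_const has_derivative_ident])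
    have "(\<lambda>s. (x, s)) ` U \<subseteq> Q" using V that by (auto simp: U_def)
    from diff_chain_within[OF path has_derivative_subset[OF F[OF that] this]]
    have "((\<lambda>s. u x s) has_derivative (\<lambda>d. blinfun_apply (F (x, t)) (0, d))) (at t)"
      by (simp add: o_def at_within_open[OF U(2,1)])
    moreover have "(\<lambda>d. blinfun_apply (F (x, t)) (0, d)) = (\<lambda>d. d *\<^sub>R blinfun_apply (F (x, t)) (0, 1))"
      by (simp add: fun_eq_iff flip: blinfun.scaleR_right)
    ultimately show ?thesis by (simp only: has_vector_derivative_def)
  qed
  show thesis using that[OF cont space time] .
qed

lemma jacobian_compose_within_convex:
  fixes g :: "real^'n \<Rightarrow> real^'m" and \<Phi> :: "real^'m \<Rightarrow> real^'l"
  assumes K: "open K" "convex K" "K \<noteq> {}" "K \<subseteq> S" and x: "x \<in> closure K"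
    and g: "(g has_derivative L) (at x within S)"
    and \<Phi>: "(\<Phi> has_derivative (\<lambda>d. jacobian \<Phi> (at (g x)) *v d)) (at (g x))"
  shows "jacobian (\<lambda>y. \<Phi> (g y)) (at x within S) = jacobian \<Phi> (at (g x)) ** jacobian g (at x within S)"
proof -
  have "((\<lambda>y. \<Phi> (g y)) has_derivative (\<lambda>d. jacobian \<Phi> (at (g x)) *v L d)) (at x within S)"
    using has_derivative_compose[OF g \<Phi>] .
  then have "jacobian (\<lambda>y. \<Phi> (g y)) (at x within S) = matrix ((*v) (jacobian \<Phi> (at (g x))) \<circ> L)"
    using jacobian_within_convex_eq[OF K x] by (simp only: o_def)
  also have "\<dots> = jacobian \<Phi> (at (g x)) ** matrix L"
    by (simp only: matrix_compose[OF has_derivative_linear[OF g] matrix_vector_mul_linear]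
        matrix_of_matrix_vector_mul)
  also have "matrix L = jacobian g (at x within S)"
    using jacobian_within_convex_eq[OF K x g] by simp
  finally show ?thesis .
qed

text \<open>Both Jacobians are continuous on the closed cell: as derivatives at its points are unique, they
  are the matrices of the continuous derivatives that \<open>C1_on\<close> provides.\<close>

lemma reconstruction_jacobian_error:
  fixes u :: "real^2 \<Rightarrow> real \<Rightarrow> real^'m" and v :: "real^2 \<Rightarrow> real^'m"
  assumes K: "open K" "convex K" "K \<noteq> {}" "K \<subseteq> closure \<Omega>" and x: "x \<in> closure K"
    and Q: "openin (top_of_set (closure \<Omega> \<times> UNIV)) Q" and u: "C1_on Q (\<lambda>(x, t). u x t)"
    and KQ: "closure K \<times> {t} \<subseteq> Q"
    and v: "C1_on (closure K) v" and acc: "reconstruction_accurate \<Omega> u t C p h K v"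
  shows "norm (jacobian v (at x within closure K) - jacobian (\<lambda>y. u y t) (at x within closure \<Omega>)) \<le> C * h ^ p"
proof -
  obtain F :: "(real^2) \<times> real \<Rightarrow> ((real^2) \<times> real) \<Rightarrow>\<^sub>L (real^'m)"
    where F: "continuous_on Q F" "\<And>x t. (x, t) \<in> Q \<Longrightarrow>
       ((\<lambda>y. u y t) has_derivative (\<lambda>d. blinfun_apply (F (x, t)) (d, 0))) (at x within closure \<Omega>)"
    by (rule space_time_derivatives[OF Q u]) blast
  \<comment> \<open>The spatial part of the space-time derivative.\<close>
  define P where "P y = F (y, t) o\<^sub>L Blinfun (\<lambda>d. (d, 0))" for y
  have embed: "bounded_linear (\<lambda>d :: real^2. (d, 0 :: real))"
    by (intro bounded_linear_Pair bounded_linear_ident bounded_linear_zero)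
  have P: "blinfun_apply (P y) = (\<lambda>d. blinfun_apply (F (y, t)) (d, 0))" for y
    by (simp add: P_def fun_eq_iff bounded_linear_Blinfun_apply[OF embed])
  have "continuous_on (closure K) (\<lambda>y. F (y, t))"
    by (rule continuous_on_compose2[OF F(1)]) (use KQ in \<open>auto intro!: continuous_intros\<close>)
  then have Pc: "continuous_on (closure K) P"
    unfolding P_def by (intro continuous_intros)
  have ju: "jacobian (\<lambda>y. u y t) (at y within closure \<Omega>) = matrix (blinfun_apply (P y))" if "y \<in> closure K" for y
    unfolding P using KQ that by (intro jacobian_within_convex_eq[OF K that] F(2)) auto
  obtain v' where v': "\<And>y. y \<in> closure K \<Longrightarrow> (v has_derivative blinfun_apply (v' y)) (at y within closure K)"
    "continuous_on (closure K) v'"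
    using v unfolding C1_on_def by blast
  have jv: "jacobian v (at y within closure K) = matrix (blinfun_apply (v' y))" if "y \<in> closure K" for y
    by (rule jacobian_within_convex_eq[OF K(1-3) closure_subset that v'(1)[OF that]])
  have cont: "continuous_on (closure K) (\<lambda>y. norm (jacobian v (at y within closure K)
      - jacobian (\<lambda>y. u y t) (at y within closure \<Omega>)))"
    using continuous_on_norm[OF continuous_on_diff[OF continuous_on_matrix_blinfun[OF v'(2)]
        continuous_on_matrix_blinfun[OF Pc]]]
    by (simp add: ju jv cong: continuous_on_cong)
  show ?thesis
    using acc by (intro esssup_le_imp_le_on_closure[OF K(1) cont _ x])
      (simp add: reconstruction_accurate_def Linf_norm_def)
qed

text \<open>Both \<open>w\<close> and the fluxes \<open>f\<^sub>i(u)\<close> depend on space through \<open>u\<close>. With \<open>D\<close> the Jacobian of \<open>\<Psi>\<close>, the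
  chain rule gives \<open>J\<^sub>i \<partial>\<^sub>i w = D A\<^sub>i D\<inverse> D \<partial>\<^sub>i u = D \<partial>\<^sub>i f\<^sub>i(u)\<close>, so the equation for \<open>w\<close> is \<open>D\<close> applied to the
  system for \<open>u\<close>.\<close>

lemma transformed_equation:
  fixes u :: "real^2 \<Rightarrow> real \<Rightarrow> real^'m"
  assumes G: "open G" "\<And>i. C1_on G (f i)" "change_of_variables G \<Psi>"
    and sol: "smooth_solution \<Omega> f Q u" and z: "(x, t) \<in> Q" and uG: "u x t \<in> G"
    and K: "open K" "convex K" "K \<noteq> {}" "K \<subseteq> closure \<Omega>" and x: "x \<in> closure K"
  shows "vector_derivative (\<lambda>s. \<Psi> (u x s)) (at t)
       = - (\<Sum>i\<in>UNIV. J_mat \<Psi> f i (u x t) *v partial_deriv (closure \<Omega>) i (\<lambda>y. \<Psi> (u y t)) x)"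
proof -
  let ?D = "jacobian \<Psi> (at (u x t))"
  let ?U = "jacobian (\<lambda>y. u y t) (at x within closure \<Omega>)"
  have \<Psi>: "C1_on G \<Psi>" "invertible ?D" using G(3) uG by (auto simp: change_of_variables_def)
  have "openin (top_of_set (closure \<Omega> \<times> UNIV)) Q" "C1_on Q (\<lambda>(x, t). u x t)"
    using sol by (simp_all add: smooth_solution_def)
  then obtain F :: "(real^2) \<times> real \<Rightarrow> ((real^2) \<times> real) \<Rightarrow>\<^sub>L (real^'m)" where
    space: "((\<lambda>y. u y t) has_derivative (\<lambda>d. blinfun_apply (F (x, t)) (d, 0))) (at x within closure \<Omega>)"
    and time: "((\<lambda>s. u x s) has_vector_derivative F (x, t) (0, 1)) (at t)"
    by (rule space_time_derivatives) (use z in blast)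
  note chain = jacobian_compose_within_convex[OF K x space C1_on_openD(1)[OF _ G(1) uG]]
  have pde: "vector_derivative (\<lambda>s. u x s) (at t)
        = - (\<Sum>i\<in>UNIV. partial_deriv (closure \<Omega>) i (\<lambda>y. f i (u y t)) x)"
    using sol z by (auto simp: smooth_solution_def add_eq_0_iff2)
  have J: "J_mat \<Psi> f i (u x t) *v partial_deriv (closure \<Omega>) i (\<lambda>y. \<Psi> (u y t)) x
      = ?D *v partial_deriv (closure \<Omega>) i (\<lambda>y. f i (u y t)) x" for i
    unfolding partial_deriv_def chain[OF \<Psi>(1)] chain[OF G(2)] J_mat_def
    by (simp only: matrix_vector_mul_assoc matrix_mul_assoc[symmetric])
      (simp only: matrix_mul_assoc[of "matrix_inv ?D"] matrix_inv_mult(2)[OF \<Psi>(2)] matrix_mul_lid)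
  have "((\<lambda>s. \<Psi> (u x s)) has_vector_derivative ?D *v F (x, t) (0, 1)) (at t)"
    using has_derivative_compose[OF time[unfolded has_vector_derivative_def] C1_on_openD(1)[OF \<Psi>(1) G(1) uG]]
    by (simp add: has_vector_derivative_def matrix_vector_mult_scaleR)
  then have "vector_derivative (\<lambda>s. \<Psi> (u x s)) (at t) = ?D *v vector_derivative (\<lambda>s. u x s) (at t)"
    using vector_derivative_at time by metis
  also have "\<dots> = - (\<Sum>i\<in>UNIV. ?D *v partial_deriv (closure \<Omega>) i (\<lambda>y. f i (u y t)) x)"
    unfolding pde by (simp add: sum_2 matrix_vector_mult_diff_distrib linear_neg[OF matrix_vector_mul_linear])
  finally show ?thesis by (simp add: J)
qed

section \<open>Consistency\<close>

lemma cells_at_node_nonempty: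
  assumes "x \<in> mesh_nodes T"
  shows "cells_at T x \<noteq> {}"
proof (cases "x \<in> mesh_vertices T")
  case True
  then obtain K where "K \<in> T" "x extreme_point_of closure K" by (auto simp: mesh_vertices_def)
  then have "K \<in> cells_at T x" by (simp add: cells_at_def extreme_point_of_def)
  then show ?thesis by blast
next
  case False
  then obtain K e where K: "K \<in> T" "e edge_of closure K" "midpoint_of_edge x e"
    using assms by (auto simp: mesh_nodes_def mesh_edges_def)
  then have "x \<in> e" by (auto simp: midpoint_of_edge_def)
  then have "K \<in> cells_at T x" using K edge_of_imp_subset by (auto simp: cells_at_def)
  then show ?thesis by blast
qed

text \<open>For the exterior cell the node is the limit of the points \<open>x - \<epsilon> \<tau>\<close> of the closed cell as \<open>\<epsilon>\<close>
  tends to \<open>0\<close>.\<close>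

lemma slot_cell_at_node:
  assumes ori: "well_oriented D" and x: "x \<in> mesh_nodes (cells D)" and e: "e \<in> edges_at (cells D) x"
    and K: "slot_cell D x e s = Some K"
  shows "K \<in> cells_at (cells D) x"
proof -
  have side: "L \<in> cells_at (cells D) x" if "side_cell (cells D) x e d = Some L" for d L
    using side_cell_SomeD[OF that] e
    by (auto simp: cells_at_def edges_at_def edge_of_def dest: face_of_imp_subset)
  show ?thesis
  proof (cases s)
    case T_ext
    then have L: "K \<in> ext_candidates (cells D) x (tang D x e)"
      using K ori x e by (auto simp: K_ext_def well_oriented_def split: if_splits)
    have "((\<lambda>\<epsilon>. x - \<epsilon> *\<^sub>R tang D x e) \<longlongrightarrow> x - 0 *\<^sub>R tang D x e) (at_right 0)"
      by (intro tendsto_intros)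
    then have "x - 0 *\<^sub>R tang D x e \<in> closure K"
      using L by (intro Lim_in_closed_set[of "closure K"]) (auto simp: ext_candidates_def)
    then show ?thesis using L by (simp add: cells_at_def ext_candidates_def)
  qed (use K side in \<open>auto simp: K_minus_def K_plus_def\<close>)
qed

lemma norm_slot_dir:
  assumes "well_oriented D" "x \<in> mesh_nodes (cells D)" "e \<in> edges_at (cells D) x"
  shows "norm (slot_dir D x e s) = 1"
  using assms by (cases s) (auto simp: well_oriented_def unit_tangent_def norml_def)

text \<open>In the frame of each edge the exact value is rewritten as the contribution of that edge with the
  exact derivatives \<open>W q\<close> in place of the one-sided ones, the viscosity being added and subtracted. By
  linearity the difference is the same contribution evaluated on the errors. The factor \<open>4\<close> counts the four upwind terms at a vertex; at a midpoint the unsplit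
  tangential term takes the place of two of them.\<close>

lemma point_operator_error:
  fixes W :: "real^2^'m::finite"
  assumes mesh: "mesh_of \<Omega> (cells D)" and ori: "well_oriented D" and x: "x \<in> mesh_nodes (cells D)"
    and B: "\<And>i y. norm (J_mat \<Psi> f i (snd uh x) *v y) \<le> B * norm y" and visc: "0 \<le> visc D x"
    and err: "\<And>e s. e \<in> edges_at (cells D) x \<Longrightarrow> norm (dw \<Psi> D uh x e s - W *v slot_dir D x e s) \<le> \<epsilon>"
  shows "norm (D_pt \<Psi> f D uh x + (\<Sum>i\<in>UNIV. J_mat \<Psi> f i (snd uh x) *v (W *v axis i 1)))
       \<le> 4 * (B + visc D x) * \<epsilon>"
proof -
  let ?v = "snd uh x" and ?\<alpha> = "visc D x" and ?n = "norml D x" and ?\<tau> = "tang D x"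
  let ?R = "\<Sum>i\<in>UNIV. J_mat \<Psi> f i ?v *v (W *v axis i 1)"
  let ?\<delta> = "\<lambda>e s. dw \<Psi> D uh x e s - W *v slot_dir D x e s"
  have "0 \<le> B * norm (1 :: real^'m)" using order_trans[OF norm_ge_zero B] .
  moreover have "norm (1 :: real^'m) > 0" by (simp add: vec_eq_iff)
  ultimately have B0: "0 \<le> B" by (simp add: zero_le_mult_iff)
  have unit: "norm (?\<tau> e) = 1" "norm (?n e) = 1" if "e \<in> edges_at (cells D) x" for e
    using norm_slot_dir[OF ori x that, of T_minus] norm_slot_dir[OF ori x that, of N_minus] by simp_all
  have bound: "norm (J_plus \<Psi> f ?\<alpha> q ?v *v ?\<delta> e s) \<le> (B + ?\<alpha>) * \<epsilon>"
      "norm (J_minus \<Psi> f ?\<alpha> q ?v *v ?\<delta> e s) \<le> (B + ?\<alpha>) * \<epsilon>"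
      "norm (J_dir \<Psi> f q ?v *v ?\<delta> e s) \<le> 2 * (B + ?\<alpha>) * \<epsilon>"
    if e: "e \<in> edges_at (cells D) x" and q: "norm q = 1" for e s q
  proof -
    have "(B + ?\<alpha>) * norm (?\<delta> e s) \<le> (B + ?\<alpha>) * \<epsilon>"
      using err[OF e] B0 visc by (intro mult_left_mono) auto
    then show "norm (J_plus \<Psi> f ?\<alpha> q ?v *v ?\<delta> e s) \<le> (B + ?\<alpha>) * \<epsilon>"
      "norm (J_minus \<Psi> f ?\<alpha> q ?v *v ?\<delta> e s) \<le> (B + ?\<alpha>) * \<epsilon>"
      using norm_J_split_le[OF B q visc, of "?\<delta> e s"] by (auto intro: order_trans)
    have "2 * B * norm (?\<delta> e s) \<le> 2 * (B + ?\<alpha>) * \<epsilon>"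
      using err[OF e] B0 visc by (intro mult_mono) auto
    then show "norm (J_dir \<Psi> f q ?v *v ?\<delta> e s) \<le> 2 * (B + ?\<alpha>) * \<epsilon>"
      using norm_J_dir_le[OF B q, of "?\<delta> e s"] by (rule order_trans[rotated])
  qed
  have frame: "J_dir \<Psi> f (?n e) ?v *v (W *v ?n e) + J_dir \<Psi> f (?\<tau> e) ?v *v (W *v ?\<tau> e) = ?R"
    if "e \<in> edges_at (cells D) x" for e
    unfolding norml_def by (rule J_dir_frame_invariance[OF unit(1)[OF that]])
  show ?thesis
  proof (cases "x \<in> mesh_vertices (cells D)")
    case True
    define E where "E e = J_plus \<Psi> f ?\<alpha> (?n e) ?v *v dw \<Psi> D uh x e N_minus
      + J_minus \<Psi> f ?\<alpha> (?n e) ?v *v dw \<Psi> D uh x e N_plus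
      + J_minus \<Psi> f ?\<alpha> (?\<tau> e) ?v *v dw \<Psi> D uh x e T_minus
      + J_plus \<Psi> f ?\<alpha> (?\<tau> e) ?v *v dw \<Psi> D uh x e T_ext" for e
    have diff: "norm (?R - E e) \<le> 4 * (B + ?\<alpha>) * \<epsilon>" if e: "e \<in> edges_at (cells D) x" for e
    proof -
      have "?R - E e = - (J_plus \<Psi> f ?\<alpha> (?n e) ?v *v ?\<delta> e N_minus
        + J_minus \<Psi> f ?\<alpha> (?n e) ?v *v ?\<delta> e N_plus
        + J_minus \<Psi> f ?\<alpha> (?\<tau> e) ?v *v ?\<delta> e T_minus
        + J_plus \<Psi> f ?\<alpha> (?\<tau> e) ?v *v ?\<delta> e T_ext)"
        unfolding frame[OF e, symmetric] E_def
          J_plus_add_J_minus[of \<Psi> f ?\<alpha>, symmetric]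
        by (simp add: matrix_vector_mult_diff_distrib)
      moreover have "norm (a + b + c + d) \<le> norm a + norm b + norm c + norm d" for a b c d :: "real^'m"
        by norm
      ultimately have "norm (?R - E e) \<le> norm (J_plus \<Psi> f ?\<alpha> (?n e) ?v *v ?\<delta> e N_minus)
        + norm (J_minus \<Psi> f ?\<alpha> (?n e) ?v *v ?\<delta> e N_plus)
        + norm (J_minus \<Psi> f ?\<alpha> (?\<tau> e) ?v *v ?\<delta> e T_minus)
        + norm (J_plus \<Psi> f ?\<alpha> (?\<tau> e) ?v *v ?\<delta> e T_ext)"
        by (simp only: norm_minus_cancel)
      then show ?thesis
        using bound(1)[OF e unit(2)[OF e], of N_minus] bound(2)[OF e unit(2)[OF e], of N_plus]
          bound(2)[OF e unit(1)[OF e], of T_minus] bound(1)[OF e unit(1)[OF e], of T_ext]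
        by linarith
    qed
    have w1: "(\<Sum>e\<in>edges_at (cells D) x. edge_weight D x e) = 1"
      by (rule sum_edge_weight_eq_1[OF mesh ori True])
    have "D_pt \<Psi> f D uh x = - (\<Sum>e\<in>edges_at (cells D) x. edge_weight D x e *\<^sub>R E e)"
      using True by (simp add: D_pt_def D_pt_vertex_def Let_def E_def)
    moreover have "?R = (\<Sum>e\<in>edges_at (cells D) x. edge_weight D x e *\<^sub>R ?R)"
      by (simp only: w1 scaleR_one flip: scaleR_left.sum)
    ultimately have "D_pt \<Psi> f D uh x + ?R = (\<Sum>e\<in>edges_at (cells D) x. edge_weight D x e *\<^sub>R (?R - E e))"
      by (simp only: scaleR_diff_right sum_subtractf uminus_add_conv_diff)
    also have "norm \<dots> \<le> (\<Sum>e\<in>edges_at (cells D) x. edge_weight D x e * (4 * (B + ?\<alpha>) * \<epsilon>))"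
      using diff by (intro sum_norm_le) (simp add: edge_weight_nonneg mult_left_mono)
    also have "\<dots> = 4 * (B + ?\<alpha>) * \<epsilon>" by (simp only: w1 mult_1_left flip: sum_distrib_right)
    finally show ?thesis .
  next
    case False
    define e where "e = (SOME e. e \<in> mesh_edges (cells D) \<and> midpoint_of_edge x e)"
    have "\<exists>e. e \<in> mesh_edges (cells D) \<and> midpoint_of_edge x e"
      using False x by (auto simp: mesh_nodes_def)
    from someI_ex[OF this] have "e \<in> mesh_edges (cells D)" "midpoint_of_edge x e" by (auto simp: e_def)
    then have e: "e \<in> edges_at (cells D) x"
      by (auto simp: edges_at_def midpoint_of_edge_def)
    have "D_pt \<Psi> f D uh x + ?R = - (J_plus \<Psi> f ?\<alpha> (?n e) ?v *v ?\<delta> e N_minus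
        + J_minus \<Psi> f ?\<alpha> (?n e) ?v *v ?\<delta> e N_plus + J_dir \<Psi> f (?\<tau> e) ?v *v ?\<delta> e T_minus)"
      unfolding frame[OF e, symmetric] J_plus_add_J_minus[of \<Psi> f ?\<alpha> "?n e", symmetric]
      using False by (simp add: D_pt_def D_pt_midpoint_def Let_def matrix_vector_mult_diff_distrib flip: e_def)
    moreover have "norm (a + b + c) \<le> norm a + norm b + norm c" for a b c :: "real^'m"
      by norm
    ultimately have "norm (D_pt \<Psi> f D uh x + ?R) \<le> norm (J_plus \<Psi> f ?\<alpha> (?n e) ?v *v ?\<delta> e N_minus)
        + norm (J_minus \<Psi> f ?\<alpha> (?n e) ?v *v ?\<delta> e N_plus) + norm (J_dir \<Psi> f (?\<tau> e) ?v *v ?\<delta> e T_minus)"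
      by (simp only: norm_minus_cancel)
    then show ?thesis
      using bound(1)[OF e unit(2)[OF e], of N_minus] bound(2)[OF e unit(2)[OF e], of N_plus]
          bound(3)[OF e unit(1)[OF e], of T_minus]
      by linarith
  qed
qed

theorem proposition3p7:
  fixes f :: "2 \<Rightarrow> real^'m \<Rightarrow> real^'m"
    and Jset :: "'j set" and g :: "'j \<Rightarrow> real^'m \<Rightarrow> real"
    and G Kc :: "(real^'m) set"
    and \<Psi> :: "real^'m \<Rightarrow> real^'m"
    and \<Omega> :: "(real^2) set"
    and Q :: "((real^2) \<times> real) set"
    and u w :: "real^2 \<Rightarrow> real \<Rightarrow> real^'m"
    and D :: "'k \<Rightarrow> 'm discretization"
    and \<sigma> :: "'k \<Rightarrow> real^2" and t h :: "'k \<Rightarrow> real" and uh :: "'k \<Rightarrow> 'm hybrid"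
    and p N :: nat
    and C Cb \<rho> \<alpha>max :: real
  assumes "finite Jset"
    and "\<And>j. j \<in> Jset \<Longrightarrow> concave_on UNIV (g j)"
    and "\<And>j. j \<in> Jset \<Longrightarrow> C1_on UNIV (g j)"
    and G_def: "G = admissible_interior Jset g"
    and "\<And>i. C1_on G (f i)"
    and "hyperbolic_on G f"
    and "change_of_variables G \<Psi>"
    and solution: "smooth_solution \<Omega> f Q u"
    and w_def: "w = (\<lambda>x s. \<Psi> (u x s))"
    and "compact Kc" and "Kc \<subseteq> G"
    and "\<And>x s. (x, s) \<in> Q \<Longrightarrow> u x s \<in> Kc"
    and "p \<ge> 1"
    and "\<rho> > 0"
    and "\<And>k. mesh_of \<Omega> (cells (D k))"
    and "\<And>k. conforming (cells (D k))"
    and "\<And>k. shape_regular \<rho> N (cells (D k))"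
    and h_def: "\<And>k. h k = mesh_size (cells (D k))"
    and "\<And>k. well_oriented (D k)"
    and "\<And>k. \<sigma> k \<in> mesh_nodes (cells (D k))"
    and neighbourhood: "\<And>k K. K \<in> cells_at (cells (D k)) (\<sigma> k) \<Longrightarrow> closure K \<times> {t k} \<subseteq> Q"
    and uh_def: "\<And>k. uh k = exact_hybrid u (t k)"
    and "\<And>k K. K \<in> cells_at (cells (D k)) (\<sigma> k) \<Longrightarrow>
           reconstructs (cells (D k)) K (uh k) (recon (D k) K (uh k))"
    and "\<And>k K. K \<in> cells_at (cells (D k)) (\<sigma> k) \<Longrightarrow>
           reconstruction_accurate \<Omega> u (t k) C p (h k) K (recon (D k) K (uh k))"
    and "\<And>k. viscosity_ok \<Psi> f (D k) (uh k) (\<sigma> k)"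
    and "\<And>k. visc (D k) (\<sigma> k) \<le> \<alpha>max"
    and "\<And>k. boundary_consistent \<Omega> \<Psi> u (t k) Cb p (D k) (\<sigma> k)"
  shows "\<exists>C'>0. \<forall>k.
      norm (D_pt \<Psi> f (D k) (uh k) (\<sigma> k)
            + (\<Sum>i\<in>UNIV. J_mat \<Psi> f i (u (\<sigma> k) (t k)) *v
                 partial_deriv (closure \<Omega>) i (\<lambda>x. w x (t k)) (\<sigma> k))) \<le> C' * h k ^ p
    \<and> norm (D_pt \<Psi> f (D k) (uh k) (\<sigma> k) - vector_derivative (\<lambda>s. w (\<sigma> k) s) (at (t k)))
        \<le> C' * h k ^ p"
proof -
  note cov = assms(7) and sol = assms(8) and Kc = assms(10,11) and uKc = assms(12)
    and mesh = assms(15) and ori = assms(19) and node = assms(20) and nbh = assms(21)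
  have "continuous_on UNIV (g j)" if "j \<in> Jset" for j
    using assms(3)[OF that] has_derivative_continuous unfolding C1_on_def continuous_on_eq_continuous_within
    by blast
  then have "open {v. g j v > 0}" if "j \<in> Jset" for j
    using that by (intro open_Collect_less) auto
  moreover have "G = (\<Inter>j\<in>Jset. {v. g j v > 0})" by (auto simp: G_def admissible_interior_def)
  ultimately have G: "open G" using assms(1) by (simp add: open_INT)
  have \<Psi>: "C1_on G \<Psi>" using cov by (simp add: change_of_variables_def)
  note \<Psi>' = C1_on_openD[OF \<Psi> G]
  obtain M where M: "M > 0" "\<And>v. v \<in> Kc \<Longrightarrow> norm (jacobian \<Psi> (at v)) \<le> M"
    using bounded_on_compact[OF Kc(1) continuous_on_subset[OF \<Psi>'(2) Kc(2)]] by blast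
  obtain B where B: "B > 0" "\<And>i v y. v \<in> Kc \<Longrightarrow> norm (J_mat \<Psi> f i v *v y) \<le> B * norm y"
    by (rule J_mat_bounded_on_compact[where f = f, OF G assms(5) cov Kc]) (rule that)
  \<comment> \<open>\<open>E\<close> bounds the derivative errors inside and at the boundary. No sign of
     \<open>C\<close> and \<open>Cb\<close> is assumed, and the sign of \<open>\<alpha>max\<close> follows only from the viscosity at some node, whence
     the absolute values; adding \<open>1\<close> makes \<open>C'\<close> positive.\<close>
  define E where "E = M * \<bar>C\<bar> + \<bar>Cb\<bar>"
  define C' where "C' = 4 * (B + \<bar>\<alpha>max\<bar>) * E + 1"
  have E0: "E \<ge> 0" using M by (simp add: E_def)
  have C'0: "C' > 0" unfolding C'_def using B(1) E0 by (intro add_nonneg_pos mult_nonneg_nonneg) auto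
  have main: "norm (D_pt \<Psi> f (D k) (uh k) (\<sigma> k)
            + (\<Sum>i\<in>UNIV. J_mat \<Psi> f i (u (\<sigma> k) (t k)) *v
                 partial_deriv (closure \<Omega>) i (\<lambda>x. w x (t k)) (\<sigma> k))) \<le> C' * h k ^ p
    \<and> vector_derivative (\<lambda>s. w (\<sigma> k) s) (at (t k))
      = - (\<Sum>i\<in>UNIV. J_mat \<Psi> f i (u (\<sigma> k) (t k)) *v
                 partial_deriv (closure \<Omega>) i (\<lambda>x. w x (t k)) (\<sigma> k))" for k
  proof -
    let ?x = "\<sigma> k" and ?t = "t k" and ?T = "cells (D k)" and ?v = "u (\<sigma> k) (t k)"
    define W where "W = jacobian (\<lambda>y. \<Psi> (u y ?t)) (at ?x within closure \<Omega>)"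
    have node_value: "snd (uh k) ?x = ?v" by (simp add: uh_def exact_hybrid_def)
    have cell: "open K" "convex K" "K \<noteq> {}" "K \<subseteq> closure \<Omega>" "?x \<in> closure K" "(?x, ?t) \<in> Q"
      if "K \<in> cells_at ?T ?x" for K
      using mesh[of k] that nbh[OF that] closure_subset by (auto simp: mesh_of_def cells_at_def)
    have "cells_at ?T ?x \<noteq> {}" by (rule cells_at_node_nonempty[OF node])
    then obtain K where K: "K \<in> cells_at ?T ?x" by blast
    have vKc: "?v \<in> Kc" using uKc cell(6)[OF K] by blast
    then have vG: "?v \<in> G" using Kc(2) by blast
    have Q: "openin (top_of_set (closure \<Omega> \<times> UNIV)) Q" "C1_on Q (\<lambda>(x, t). u x t)"
      using sol by (simp_all add: smooth_solution_def)
    have pde: "vector_derivative (\<lambda>s. w ?x s) (at ?t)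
      = - (\<Sum>i\<in>UNIV. J_mat \<Psi> f i ?v *v partial_deriv (closure \<Omega>) i (\<lambda>x. w x ?t) ?x)"
      unfolding w_def
      by (rule transformed_equation[OF G assms(5) cov sol cell(6)[OF K] vG cell(1-5)[OF K]])
    have "finite ?T" "K \<in> ?T" "bounded K"
      using mesh[of k] K polytope_imp_bounded bounded_subset[OF _ closure_subset]
      by (auto simp: mesh_of_def cells_at_def)
    then have "0 \<le> diameter K" "diameter K \<le> h k"
      by (auto simp: h_def mesh_size_def diameter_ge_0)
    then have h0: "0 \<le> h k ^ p" by simp
    have err: "norm (dw \<Psi> (D k) (uh k) ?x e s - W *v slot_dir (D k) ?x e s) \<le> E * h k ^ p"
      if e: "e \<in> edges_at ?T ?x" for e s
    proof (cases "slot_cell (D k) ?x e s")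
      case None
      have "norm (dw \<Psi> (D k) (uh k) ?x e s - W *v slot_dir (D k) ?x e s) \<le> Cb * h k ^ p"
        using assms(27)[of k] e None by (simp add: boundary_consistent_def dw_def W_def h_def)
      also have "\<dots> \<le> E * h k ^ p"
        using h0 M(1) by (intro mult_right_mono) (auto simp: E_def intro: add_increasing)
      finally show ?thesis .
    next
      case (Some L)
      have L: "L \<in> cells_at ?T ?x" by (rule slot_cell_at_node[OF ori node e Some])
      let ?R = "jacobian (recon (D k) L (uh k)) (at ?x within closure L)"
      let ?U = "jacobian (\<lambda>y. u y ?t) (at ?x within closure \<Omega>)"
      obtain F :: "(real^2) \<times> real \<Rightarrow> ((real^2) \<times> real) \<Rightarrow>\<^sub>L (real^'m)" where
        du: "((\<lambda>y. u y ?t) has_derivative (\<lambda>d. blinfun_apply (F (?x, ?t)) (d, 0))) (at ?x within closure \<Omega>)"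
        by (rule space_time_derivatives[OF Q]) (use cell(6)[OF L] in blast)
      have W: "W = jacobian \<Psi> (at ?v) ** ?U"
        unfolding W_def by (rule jacobian_compose_within_convex[OF cell(1-5)[OF L] du \<Psi>'(1)[OF vG]])
      have "norm (?R - ?U) \<le> C * h k ^ p"
        using assms(23,24)[OF L] nbh[OF L] unfolding reconstructs_def
        by (intro reconstruction_jacobian_error[OF cell(1-5)[OF L] Q]) auto
      also have "\<dots> \<le> \<bar>C\<bar> * h k ^ p" using h0 by (intro mult_right_mono) auto
      finally have RU: "norm (?R - ?U) \<le> \<bar>C\<bar> * h k ^ p" .
      have "dw \<Psi> (D k) (uh k) ?x e s - W *v slot_dir (D k) ?x e s
          = jacobian \<Psi> (at ?v) *v ((?R - ?U) *v slot_dir (D k) ?x e s)"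
        by (simp add: dw_def Some node_value W matrix_vector_mult_diff_distrib matrix_vector_mult_diff_rdistrib
            flip: matrix_vector_mul_assoc)
      also have "norm \<dots> \<le> norm (jacobian \<Psi> (at ?v)) * (norm (?R - ?U) * norm (slot_dir (D k) ?x e s))"
        by (intro order_trans[OF norm_matrix_vector_mult_le] mult_left_mono norm_matrix_vector_mult_le) simp
      also have "\<dots> \<le> M * (\<bar>C\<bar> * h k ^ p)"
        using M(2)[OF vKc] RU M(1) by (simp add: norm_slot_dir[OF ori node e] mult_mono)
      also have "\<dots> \<le> E * h k ^ p" using h0 by (simp add: E_def distrib_right mult.assoc)
      finally show ?thesis .
    qed
    have visc: "0 \<le> visc (D k) ?x" "visc (D k) ?x \<le> \<bar>\<alpha>max\<bar>"
      using assms(25,26)[of k] by (auto simp: viscosity_ok_def)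
    have "norm (D_pt \<Psi> f (D k) (uh k) ?x + (\<Sum>i\<in>UNIV. J_mat \<Psi> f i ?v *v (W *v axis i 1)))
        \<le> 4 * (B + visc (D k) ?x) * (E * h k ^ p)"
      using point_operator_error[OF mesh ori node _ visc(1) err, where B = B] B(2)[OF vKc]
      unfolding node_value by blast
    also have "\<dots> \<le> 4 * (B + \<bar>\<alpha>max\<bar>) * (E * h k ^ p)"
      using visc h0 E0 by (intro mult_right_mono) auto
    also have "\<dots> \<le> C' * h k ^ p" using h0 by (simp add: C'_def distrib_right mult.assoc)
    finally show ?thesis using pde by (simp add: partial_deriv_def W_def w_def)
  qed
  show ?thesis
  proof (intro exI[of _ C'] conjI allI C'0)
    fix k
    note m = main[of k]
    show "norm (D_pt \<Psi> f (D k) (uh k) (\<sigma> k)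
            + (\<Sum>i\<in>UNIV. J_mat \<Psi> f i (u (\<sigma> k) (t k)) *v
                 partial_deriv (closure \<Omega>) i (\<lambda>x. w x (t k)) (\<sigma> k))) \<le> C' * h k ^ p"
      using m by blast
    then show "norm (D_pt \<Psi> f (D k) (uh k) (\<sigma> k) - vector_derivative (\<lambda>s. w (\<sigma> k) s) (at (t k)))
        \<le> C' * h k ^ p"
      by (simp only: m[THEN conjunct2] diff_minus_eq_add)
  qed
qed

end
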